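(* Let $\alpha\in(0,1)$, $p\in[1,\infty]$, and assume (Mass regularity), (Known covariate shift) and (Endpoint accuracy at $p$), all stated in the context. Fix $\delta\in(0,1)$ and $n,m\ge1$ such that $$2\mu_{\rm up}w_{\max}^{1/p}\epsilon_p(n,\delta/4)+(2-\alpha)\eta^w_m(\delta)<2\mu_{\rm low}r_-,$$ $$2\mu_{\rm up}w_{\max}^{1/p}\epsilon_p(n,\delta/4)+(2-\alpha)\eta^w_m(\delta)+\frac{(1-\alpha)w_{\max}}{m}\le2\mu_{\rm low}r_+ .$$ Then there is an event $\mathcal A^w_{n,m}(\delta)$, measurable with respect to $(\mathcal D^{\rm tr}_n,\mathcal D^{\rm cal}_m)$, with probability at least $1-\delta$, on which $\widehat Q^w_m(x)$ is finite for $Q_X$-almost every $x$ and $$\bigl\||\hat{\mathcal C}^w_\alpha(\cdot)|-|\mathcal C^\star_\alpha(\cdot)|\bigr\|_{L^p(Q_X)}\le2\Bigl(1+\frac{\mu_{\rm up}}{\mu_{\rm low}}\Bigr)w_{\max}^{1/p}\epsilon_p(n,\delta/4)+\frac{(2-\alpha)\eta^w_m(\delta)+(1-\alpha)\|w\|_{L^p(Q_X)}/m}{\mu_{\rm low}} .$$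
   Context: Convention: $w_{\max}^{1/\infty}=1$. Setup. $\mathcal X$ is a measurable space, $P_X$ a probability measure on $\mathcal X$, $x\mapsto P_{Y\mid X=x}$ a probability kernel from $\mathcal X$ to $\mathbb R$, and $P_{XY}=P_X\otimes P_{Y\mid X}$ (source law). For $\tau\in(0,1)$, $f^\star_\tau(x)=\inf\{t\in\mathbb R: P_{Y\mid X=x}((-\infty,t])\ge\tau\}$. Oracle interval $\mathcal C^\star_\alpha(x)=[f^\star_{\alpha/2}(x),f^\star_{1-\alpha/2}(x)]$. $|\cdot|$ of a set denotes Lebesgue length. (Mass regularity) There are constants $0<\mu_{\rm low}\le\mu_{\rm up}<\infty$, $r_0>0$ and a measurable set $\mathcal X_0$ with $P_X(\mathcal X_0)=1$ such that for every $x\in\mathcal X_0$: $P_{Y\mid X=x}([u,v])\le\mu_{\rm up}(v-u)$ for all finite $u\le v$; and for $\tau\in\{\alpha/2,1-\alpha/2\}$ and $0\le h\le r_0$, $P_{Y\mid X=x}([f^\star_\tau(x)-h,f^\star_\tau(x)])\ge\mu_{\rm low}h$ and $P_{Y\mid X=x}([f^\star_\tau(x),f^\star_\tau(x)+h])\ge\mu_{\rm low}h$. (Known covariate shift) $Q_X$ is a probability measure on $\mathcal X$ with $Q_X\ll P_X$; the likelihood ratio $w=dQ_X/dP_X$ and a deterministic constant $w_{\max}<\infty$ with $0\le w\le w_{\max}$ are known. $\chi^2(Q_X\Vert P_X)=\int(w-1)^2\,dP_X$. Samples. $\mathcal D^{\rm tr}_n\sim P_{XY}^{\otimes n}$ and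 $\mathcal D^{\rm cal}_m=\{(X_j,Y_j)\}_{j=1}^m\sim P_{XY}^{\otimes m}$ are independent. The training sample produces finite real-valued raw maps $(\mathcal D^{\rm tr}_n,x)\mapsto\widetilde f_{n,\tau}(x)$, jointly measurable, for $\tau\in\{\alpha/2,1-\alpha/2\}$. (Endpoint accuracy at $p$) There is $\epsilon_p:\mathbb N\times(0,1)\to[0,\infty)$ such that for every $n\in\mathbb N$, $\delta\in(0,1)$, $\tau\in\{\alpha/2,1-\alpha/2\}$: $\mathbb P_{\mathcal D^{\rm tr}_n}(\|\widetilde f_{n,\tau}-f^\star_\tau\|_{L^p(P_X)}\le\epsilon_p(n,\delta))\ge1-\delta$. Weighted CQR. Sorted endpoints $\hat f_{n,\alpha/2}=\widetilde f_{n,\alpha/2}\wedge\widetilde f_{n,1-\alpha/2}$, $\hat f_{n,1-\alpha/2}=\widetilde f_{n,\alpha/2}\vee\widetilde f_{n,1-\alpha/2}$; score $\widehat S(x,y)=\max\{\hat f_{n,\alpha/2}(x)-y,\;y-\hat f_{n,1-\alpha/2}(x)\}$; $\widehat S_j=\widehat S(X_j,Y_j)$. For $x$ with $w(x)>0$ (a set of full $Q_X$-measure), $\widehat Q^w_m(x)\in(-\infty,+\infty]$ is the $(1-\alpha)$-quantile (smallest $t$ such that $(-\infty,t]$ has mass at least $1-\alpha$, and $+\infty$ if no such real $t$ exists) of the probability measure $$\sum_{j=1}^m\frac{w(X_j)}{\sum_{i=1}^mw(X_i)+w(x)}\,\delta_{\widehat S_j}+\frac{w(x)}{\sum_{i=1}^mw(X_i)+w(x)}\,\delta_{+\infty}.$$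 The weighted CQR set is $\hat{\mathcal C}^w_\alpha(x)=\{y\in\mathbb R:\widehat S(x,y)\le\widehat Q^w_m(x)\}$. Scales: $\eta^w_m(\delta)=9\sqrt{\frac{(1+\chi^2(Q_X\Vert P_X))\log(4/\delta)}{m}}+\frac{4w_{\max}\log(4/\delta)}{3m}$, $r_-=r_0\wedge\frac{1-\alpha}{2\mu_{\rm up}}$, $r_+=r_0$. *)

theory Defs
  imports "HOL-Probability.Probability"
begin

text \<open>Extended-valued \<open>L\<^sup>p\<close> norms, \<open>p \<in> [1,\<infinity>]\<close>. They take the value \<open>\<infinity>\<close> on functions outside
  \<open>L\<^sup>p\<close>, so a bound on the norm also asserts membership in \<open>L\<^sup>p\<close>.\<close>

(* only meant for q > 0 *)
definition ennreal_powr :: "ennreal \<Rightarrow> real \<Rightarrow> ennreal" where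
  "ennreal_powr a q = (if a = \<infinity> then \<infinity> else ennreal (enn2real a powr q))"

definition Lp_norm :: "ereal \<Rightarrow> 'a measure \<Rightarrow> ('a \<Rightarrow> ereal) \<Rightarrow> ennreal" where
  "Lp_norm p M f =
     (if p = \<infinity> then esssup M (\<lambda>x. e2ennreal \<bar>f x\<bar>)
      else ennreal_powr (\<integral>\<^sup>+ x. ennreal_powr (e2ennreal \<bar>f x\<bar>) (real_of_ereal p) \<partial>M)
             (1 / real_of_ereal p))"

text \<open>\<open>c\<^bsup>1/p\<^esup>\<close>, with \<open>c\<^bsup>1/\<infinity>\<^esup> = 1\<close>.\<close>
definition root_exponent :: "real \<Rightarrow> ereal \<Rightarrow> real" where
  "root_exponent c p = (if p = \<infinity> then 1 else c powr (1 / real_of_ereal p))"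

definition len :: "real set \<Rightarrow> ereal" where
  "len A = enn2ereal (emeasure lborel A)"


definition joint_law :: "'x measure \<Rightarrow> ('x \<Rightarrow> real measure) \<Rightarrow> ('x \<times> real) measure" where
  "joint_law PX K = PX \<bind> (\<lambda>x. K x \<bind> (\<lambda>y. return (PX \<Otimes>\<^sub>M borel) (x, y)))"

text \<open>The law of an i.i.d. sample of size \<open>n\<close>, indexed by \<open>{0..<n}\<close>.\<close>
definition sample_law ::
    "'x measure \<Rightarrow> ('x \<Rightarrow> real measure) \<Rightarrow> nat \<Rightarrow> (nat \<Rightarrow> 'x \<times> real) measure" where
  "sample_law PX K n = (\<Pi>\<^sub>M i\<in>{..<n}. joint_law PX K)"

definition cond_quantile :: "('x \<Rightarrow> real measure) \<Rightarrow> real \<Rightarrow> 'x \<Rightarrow> real" where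
  "cond_quantile K \<tau> x = Inf {t. \<tau> \<le> measure (K x) {..t}}"

definition oracle_interval :: "('x \<Rightarrow> real measure) \<Rightarrow> real \<Rightarrow> 'x \<Rightarrow> real set" where
  "oracle_interval K \<alpha> x = {cond_quantile K (\<alpha>/2) x .. cond_quantile K (1 - \<alpha>/2) x}"


definition mass_regularity ::
    "'x measure \<Rightarrow> ('x \<Rightarrow> real measure) \<Rightarrow> real \<Rightarrow> real \<Rightarrow> real \<Rightarrow> real \<Rightarrow> bool" where
  "mass_regularity PX K \<alpha> \<mu>_low \<mu>_up r0 \<longleftrightarrow>
     0 < \<mu>_low \<and> \<mu>_low \<le> \<mu>_up \<and> 0 < r0 \<and>
     (\<exists>X0 \<in> sets PX. measure PX X0 = 1 \<and>
        (\<forall>x\<in>X0.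
           (\<forall>u v. u \<le> v \<longrightarrow> measure (K x) {u..v} \<le> \<mu>_up * (v - u)) \<and>
           (\<forall>\<tau>\<in>{\<alpha>/2, 1 - \<alpha>/2}. \<forall>h. 0 \<le> h \<and> h \<le> r0 \<longrightarrow>
              \<mu>_low * h \<le> measure (K x) {cond_quantile K \<tau> x - h .. cond_quantile K \<tau> x} \<and>
              \<mu>_low * h \<le> measure (K x) {cond_quantile K \<tau> x .. cond_quantile K \<tau> x + h})))"

definition covariate_shift ::
    "'x measure \<Rightarrow> 'x measure \<Rightarrow> ('x \<Rightarrow> real) \<Rightarrow> real \<Rightarrow> bool" where
  "covariate_shift PX QX w w_max \<longleftrightarrow>
     prob_space QX \<and> absolutely_continuous PX QX \<and>
     w \<in> borel_measurable PX \<and> QX = density PX (\<lambda>x. ennreal (w x)) \<and>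
     (\<forall>x\<in>space PX. 0 \<le> w x \<and> w x \<le> w_max)"

text \<open>\<open>\<chi>\<^sup>2(Q\<^sub>X \<parallel> P\<^sub>X)\<close> in terms of \<open>w = dQ\<^sub>X/dP\<^sub>X\<close>; \<open>w\<close> is bounded wherever this is used, so the
  integral exists.\<close>
definition chi_square :: "'x measure \<Rightarrow> ('x \<Rightarrow> real) \<Rightarrow> real" where
  "chi_square PX w = (\<integral>x. (w x - 1)\<^sup>2 \<partial>PX)"

text \<open>A training procedure maps a sample size \<open>n\<close>, a sample \<open>D\<close> of that size, a level \<open>\<tau>\<close> and a
  covariate \<open>x\<close> to the raw endpoint.\<close>
type_synonym 'x training = "nat \<Rightarrow> (nat \<Rightarrow> 'x \<times> real) \<Rightarrow> real \<Rightarrow> 'x \<Rightarrow> real"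

definition measurable_training ::
    "'x measure \<Rightarrow> ('x \<Rightarrow> real measure) \<Rightarrow> real \<Rightarrow> 'x training \<Rightarrow> bool" where
  "measurable_training PX K \<alpha> f \<longleftrightarrow>
     (\<forall>n\<ge>1. \<forall>\<tau>\<in>{\<alpha>/2, 1 - \<alpha>/2}.
        (\<lambda>(D, x). f n D \<tau> x) \<in> borel_measurable (sample_law PX K n \<Otimes>\<^sub>M PX))"

definition endpoint_accuracy ::
    "ereal \<Rightarrow> 'x measure \<Rightarrow> ('x \<Rightarrow> real measure) \<Rightarrow> real \<Rightarrow> 'x training \<Rightarrow>
      (nat \<Rightarrow> real \<Rightarrow> real) \<Rightarrow> bool" where
  "endpoint_accuracy p PX K \<alpha> f \<epsilon> \<longleftrightarrow>
     (\<forall>n\<ge>1. \<forall>\<delta>. 0 < \<delta> \<and> \<delta> < 1 \<longrightarrow>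
        0 \<le> \<epsilon> n \<delta> \<and>
        (\<forall>\<tau>\<in>{\<alpha>/2, 1 - \<alpha>/2}.
           measure (sample_law PX K n)
             {D \<in> space (sample_law PX K n).
                Lp_norm p PX (\<lambda>x. ereal (f n D \<tau> x - cond_quantile K \<tau> x)) \<le> ennreal (\<epsilon> n \<delta>)}
           \<ge> 1 - \<delta>))"


text \<open>Below, \<open>g\<close> is the trained map \<open>\<tau> \<mapsto> x \<mapsto> g \<tau> x\<close> and \<open>D\<close> the calibration sample.\<close>

definition lower_endpoint :: "real \<Rightarrow> (real \<Rightarrow> 'x \<Rightarrow> real) \<Rightarrow> 'x \<Rightarrow> real" where
  "lower_endpoint \<alpha> g x = min (g (\<alpha>/2) x) (g (1 - \<alpha>/2) x)"

definition upper_endpoint :: "real \<Rightarrow> (real \<Rightarrow> 'x \<Rightarrow> real) \<Rightarrow> 'x \<Rightarrow> real" where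
  "upper_endpoint \<alpha> g x = max (g (\<alpha>/2) x) (g (1 - \<alpha>/2) x)"

definition score :: "real \<Rightarrow> (real \<Rightarrow> 'x \<Rightarrow> real) \<Rightarrow> 'x \<Rightarrow> real \<Rightarrow> real" where
  "score \<alpha> g x y = max (lower_endpoint \<alpha> g x - y) (y - upper_endpoint \<alpha> g x)"

text \<open>The weighted sum of point masses at the \<open>m\<close> calibration scores (indices \<open>j < m\<close>) and at
  \<open>\<infinity>\<close> (index \<open>m\<close>). It is a probability measure when \<open>w x > 0\<close>, which holds for \<open>Q\<^sub>X\<close>-almost every
  \<open>x\<close>; elsewhere it is irrelevant.\<close>
definition weighted_score_law ::
    "real \<Rightarrow> ('x \<Rightarrow> real) \<Rightarrow> (real \<Rightarrow> 'x \<Rightarrow> real) \<Rightarrow> nat \<Rightarrow> (nat \<Rightarrow> 'x \<times> real) \<Rightarrow> 'x \<Rightarrow> ereal measure" where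
  "weighted_score_law \<alpha> w g m D x =
     distr
       (point_measure {..m}
          (\<lambda>j. ennreal ((if j < m then w (fst (D j)) else w x) / ((\<Sum>i<m. w (fst (D i))) + w x))))
       borel
       (\<lambda>j. if j < m then ereal (score \<alpha> g (fst (D j)) (snd (D j))) else \<infinity>)"

text \<open>For \<open>q > 0\<close> and a probability measure without mass at \<open>-\<infinity>\<close>, the infimum is attained if the
  set is nonempty; it is \<open>\<infinity>\<close> if no real \<open>t\<close> qualifies.\<close>
definition ereal_quantile :: "ereal measure \<Rightarrow> real \<Rightarrow> ereal" where
  "ereal_quantile N q = Inf {ereal t | t. q \<le> measure N {..ereal t}}"

definition weighted_threshold ::
    "real \<Rightarrow> ('x \<Rightarrow> real) \<Rightarrow> (real \<Rightarrow> 'x \<Rightarrow> real) \<Rightarrow> nat \<Rightarrow> (nat \<Rightarrow> 'x \<times> real) \<Rightarrow> 'x \<Rightarrow> ereal" where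
  "weighted_threshold \<alpha> w g m D x = ereal_quantile (weighted_score_law \<alpha> w g m D x) (1 - \<alpha>)"

definition weighted_cqr_set ::
    "real \<Rightarrow> ('x \<Rightarrow> real) \<Rightarrow> (real \<Rightarrow> 'x \<Rightarrow> real) \<Rightarrow> nat \<Rightarrow> (nat \<Rightarrow> 'x \<times> real) \<Rightarrow> 'x \<Rightarrow> real set" where
  "weighted_cqr_set \<alpha> w g m D x = {y. ereal (score \<alpha> g x y) \<le> weighted_threshold \<alpha> w g m D x}"


definition eta_w :: "'x measure \<Rightarrow> ('x \<Rightarrow> real) \<Rightarrow> real \<Rightarrow> nat \<Rightarrow> real \<Rightarrow> real" where
  "eta_w PX w w_max m \<delta> =
     9 * sqrt ((1 + chi_square PX w) * ln (4/\<delta>) / real m) + 4 * w_max * ln (4/\<delta>) / (3 * real m)"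

definition r_minus :: "real \<Rightarrow> real \<Rightarrow> real \<Rightarrow> real" where
  "r_minus r0 \<alpha> \<mu>_up = min r0 ((1 - \<alpha>) / (2 * \<mu>_up))"

definition r_plus :: "real \<Rightarrow> real" where
  "r_plus r0 = r0"

end

theory Submission
  imports Defs
begin

text \<open>
  Let \<open>e = \<epsilon> n (\<delta>/4)\<close>, let \<open>R\<close> stand for \<open>w_max\<^bsup>1/p\<^esup>\<close>, let \<open>\<eta>\<close> be the concentration scale, and let
  \<open>t = (2 \<mu>_up R e + (2 - \<alpha>) \<eta>) / (2 \<mu>_low)\<close>. The proof shows that, with probability at least \<open>1 - \<delta>\<close>,
  the threshold of weighted conformalised quantile regression lies in \<open>[- t, t]\<close> at every test
  covariate. The prediction interval is then the fitted interval, widened or narrowed by at most \<open>t\<close>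
  at each end, so its length differs from the oracle length by at most the sum of the two endpoint
  errors plus \<open>2 t\<close>. Taking norms under \<open>QX\<close>, where a norm is at most \<open>R\<close> times the one under \<open>PX\<close>,
  gives \<open>2 R e + 2 t\<close>, and \<open>2 t\<close> is \<open>2 (\<mu>_up / \<mu>_low) R e + (2 - \<alpha>) \<eta> / \<mu>_low\<close>.

  Why \<open>[- t, t]\<close>? By mass regularity, the interval widened by \<open>t\<close> has conditional coverage at least
  \<open>1 - \<alpha> + 2 \<mu>_low t - \<mu>_up d x\<close>, where \<open>d x\<close> is the endpoint error at \<open>x\<close> (\<open>AE_regular\<close>). The mean of
  \<open>d\<close> under \<open>QX\<close> is at most \<open>2 R e\<close>, so the mean coverage under the shifted law exceeds \<open>1 - \<alpha>\<close> by at
  least \<open>(2 - \<alpha>) \<eta>\<close>; symmetrically, the interval narrowed by \<open>t\<close> falls short by \<open>(2 - \<alpha>) \<eta>\<close>. Whether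
  the empirical quantile exceeds \<open>t\<close> or falls below \<open>- t\<close> is decided by the signs of the sums of
  \<open>w(X\<^sub>j) (1[S\<^sub>j \<le> s] - (1 - \<alpha>))\<close> for \<open>s = t\<close> and \<open>s = - t\<close>, apart from the mass placed at \<open>\<infinity>\<close> by the test
  point.

  That mass is the only way in which the threshold depends on the covariate, and it contributes at
  most \<open>(1 - \<alpha>) w_max\<close> to the first sum. This is at most of the order of the linear term
  \<open>4 w_max ln (4/\<delta>) / 3\<close> of \<open>m \<eta>\<close> and can be absorbed there. Hence the two fixed levels \<open>t\<close> and \<open>- t\<close>
  serve all covariates at once, and two one-sided Bernstein bounds, each failing with probability
  at most \<open>\<delta>/4\<close>, suffice (\<open>Bernstein_upper_tail\<close>, \<open>calibration_probability\<close>). The remaining \<open>\<delta>/2\<close> is spent on the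
  accuracy of the two endpoints.
\<close>

section \<open>Bernstein's inequality\<close>

lemma exp_le_quadratic:
  fixes x :: real
  assumes "x \<le> 1"
  shows "exp x \<le> 1 + x + x\<^sup>2"
proof (cases "0 \<le> x")
  case True
  then show ?thesis using exp_bound assms by auto
next
  case False
  define y where "y = - x"
  have y: "0 < y" using False by (simp add: y_def)
  have lower: "1 + y + y\<^sup>2 / 2 \<le> exp y"
    using exp_lower_Taylor_quadratic[of y] y by simp
  have pos: "0 < 1 + y + y\<^sup>2 / 2" using y by (intro add_pos_nonneg) auto
  have "(1 - y + y\<^sup>2) * (1 + y + y\<^sup>2 / 2) = 1 + y\<^sup>2 / 2 + y ^ 3 / 2 + y ^ 4 / 2"
    by (simp add: field_simps power2_eq_square power3_eq_cube power4_eq_xxxx)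
  also have "\<dots> \<ge> 1" using y by simp
  finally have "1 / (1 + y + y\<^sup>2 / 2) \<le> 1 - y + y\<^sup>2"
    using pos by (simp add: divide_le_eq)
  moreover have "exp x \<le> 1 / (1 + y + y\<^sup>2 / 2)"
  proof -
    have "exp x = inverse (exp y)" by (simp add: y_def exp_minus)
    also have "\<dots> \<le> inverse (1 + y + y\<^sup>2 / 2)" using lower pos by (rule le_imp_inverse_le)
    finally show ?thesis by (simp only: inverse_eq_divide)
  qed
  ultimately show ?thesis by (simp add: y_def)
qed

text \<open>A crude form of Bernstein's inequality with the second moment in place of the variance. The
  Chernoff bound is used with \<open>l = min (sqrt (L / (m V))) (1 / b)\<close>: the cap \<open>1 / b\<close> keeps \<open>l * U \<le> 1\<close>,
  where the quadratic bound on \<open>exp\<close> is valid, and produces the linear term \<open>b * L\<close>. Working with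
  the uncentred \<open>U\<close> is harmless because \<open>1 + l E U + l\<^sup>2 V \<le> exp (l E U + l\<^sup>2 V)\<close>.\<close>
lemma (in prob_space) Bernstein_upper_tail:
  fixes U :: "'a \<Rightarrow> real" and b V L :: real and m :: nat
  assumes U[measurable]: "U \<in> borel_measurable M"
    and bound: "\<And>x. x \<in> space M \<Longrightarrow> \<bar>U x\<bar> \<le> b"
    and second: "expectation (\<lambda>x. (U x)\<^sup>2) \<le> V"
    and pos: "0 < b" "0 < V" "0 < L" "1 \<le> m"
  shows "measure (\<Pi>\<^sub>M i\<in>{..<m}. M)
           {z \<in> space (\<Pi>\<^sub>M i\<in>{..<m}. M).
              m * expectation U + 2 * sqrt (m * V * L) + b * L \<le> (\<Sum>i<m. U (z i))}
         \<le> exp (- L)"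
proof -
  let ?P = "\<Pi>\<^sub>M i\<in>{..<m}. M"
  define c where "c = m * expectation U + 2 * sqrt (m * V * L) + b * L"
  define l where "l = min (sqrt (L / (m * V))) (1 / b)"
  have l_pos: "0 < l" using pos by (simp add: l_def)
  interpret P: product_sigma_finite "\<lambda>_. M" by standard
  have int_U: "integrable M U"
    by (rule integrable_const_bound[where B=b]) (use bound in auto)
  have int_U2: "integrable M (\<lambda>x. (U x)\<^sup>2)"
  proof (rule integrable_const_bound[where B="b\<^sup>2"])
    show "AE x in M. norm ((U x)\<^sup>2) \<le> b\<^sup>2"
      using bound by (intro AE_I2) (use abs_le_square_iff[of _ b] pos in force)
  qed simp
  have lU: "l * U x \<le> 1" if "x \<in> space M" for x
  proof -
    have "l * U x \<le> l * b" using bound[OF that] l_pos by (intro mult_left_mono) auto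
    also have "\<dots> \<le> (1 / b) * b" using pos by (intro mult_right_mono) (auto simp: l_def)
    finally show ?thesis using pos by simp
  qed
  have mgf: "(\<integral>\<^sup>+x. ennreal (exp (l * U x)) \<partial>M) \<le> ennreal (exp (l * expectation U + l\<^sup>2 * V))"
  proof -
    have "(\<integral>\<^sup>+x. ennreal (exp (l * U x)) \<partial>M) \<le> (\<integral>\<^sup>+x. ennreal (1 + l * U x + (l * U x)\<^sup>2) \<partial>M)"
      by (intro nn_integral_mono ennreal_leI exp_le_quadratic lU)
    also have "\<dots> = ennreal (\<integral>x. 1 + l * U x + (l * U x)\<^sup>2 \<partial>M)"
    proof (rule nn_integral_eq_integral)
      show "integrable M (\<lambda>x. 1 + l * U x + (l * U x)\<^sup>2)"
        using int_U int_U2 by (simp add: power_mult_distrib)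
      show "AE x in M. 0 \<le> 1 + l * U x + (l * U x)\<^sup>2"
      proof (rule AE_I2)
        fix x
        have "0 \<le> (1 + l * U x / 2)\<^sup>2 + 3 / 4 * (l * U x)\<^sup>2" by simp
        then show "0 \<le> 1 + l * U x + (l * U x)\<^sup>2" by (simp add: power2_eq_square algebra_simps)
      qed
    qed
    also have "(\<integral>x. 1 + l * U x + (l * U x)\<^sup>2 \<partial>M)
        = 1 + l * expectation U + l\<^sup>2 * expectation (\<lambda>x. (U x)\<^sup>2)"
      using int_U int_U2 by (simp add: power_mult_distrib prob_space)
    also have "\<dots> \<le> 1 + (l * expectation U + l\<^sup>2 * V)"
      using second by (simp add: mult_left_mono)
    also have "\<dots> \<le> exp (l * expectation U + l\<^sup>2 * V)" by (rule exp_ge_add_one_self)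
    finally show ?thesis by (simp add: ennreal_leI)
  qed
  have exponent: "- l * c + m * (l * expectation U + l\<^sup>2 * V) \<le> - L"
  proof -
    have root: "sqrt (L / (m * V)) * sqrt (m * V * L) = L"
      using pos by (simp add: real_sqrt_mult[symmetric])
    have "m * V * sqrt (L / (m * V)) = sqrt (m * V * L)"
    proof -
      have "sqrt (m * V * L) = sqrt ((m * V)\<^sup>2 * (L / (m * V)))"
        using pos by (simp add: power2_eq_square)
      also have "\<dots> = m * V * sqrt (L / (m * V))"
        using pos by (subst real_sqrt_mult) simp
      finally show ?thesis ..
    qed
    then have "m * V * l \<le> sqrt (m * V * L)"
      using pos mult_left_mono[of l "sqrt (L / (m * V))" "m * V"] by (simp add: l_def)
    then have quad: "m * (l\<^sup>2 * V) \<le> l * sqrt (m * V * L)"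
      using l_pos mult_left_mono[of "m * V * l" _ l] by (simp add: power2_eq_square ac_simps)
    \<comment> \<open>Either value of the minimum makes one of the two summands equal to \<open>L\<close>.\<close>
    have "L \<le> l * sqrt (m * V * L) + l * b * L"
    proof (cases "sqrt (L / (m * V)) \<le> 1 / b")
      case True
      then have "l * sqrt (m * V * L) = L" using root by (simp add: l_def)
      then show ?thesis using pos l_pos by simp
    next
      case False
      then have "l * b = 1" using pos by (simp add: l_def)
      then show ?thesis using pos l_pos by simp
    qed
    then show ?thesis using quad by (simp add: c_def algebra_simps)
  qed
  have "(\<integral>\<^sup>+z. (\<Prod>i<m. ennreal (exp (l * U (z i)))) * indicator (space ?P) z \<partial>?P)
      = (\<integral>\<^sup>+z. (\<Prod>i<m. ennreal (exp (l * U (z i)))) \<partial>?P)"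
    by (intro nn_integral_cong) simp
  also have "\<dots> = (\<Prod>i<m. \<integral>\<^sup>+x. ennreal (exp (l * U x)) \<partial>M)"
    by (rule P.product_nn_integral_prod) auto
  also have "\<dots> = (\<integral>\<^sup>+x. ennreal (exp (l * U x)) \<partial>M) ^ m" by simp
  also have "\<dots> \<le> ennreal (exp (l * expectation U + l\<^sup>2 * V)) ^ m"
    using mgf by (rule power_mono_ennreal)
  also have "\<dots> = ennreal (exp (m * (l * expectation U + l\<^sup>2 * V)))"
    by (simp only: ennreal_power exp_ge_zero exp_of_nat_mult)
  finally have moment: "(\<integral>\<^sup>+z. (\<Prod>i<m. ennreal (exp (l * U (z i)))) * indicator (space ?P) z \<partial>?P)
      \<le> ennreal (exp (m * (l * expectation U + l\<^sup>2 * V)))" .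
  have "emeasure ?P {z \<in> space ?P. c \<le> (\<Sum>i<m. U (z i))}
      = emeasure ?P {z \<in> space ?P. 1 \<le> ennreal (exp (- l * c)) * (\<Prod>i<m. ennreal (exp (l * U (z i))))}"
  proof (rule arg_cong[where f="emeasure ?P"], rule Collect_cong, rule conj_cong[OF refl])
    fix z
    have "ennreal (exp (- l * c)) * (\<Prod>i<m. ennreal (exp (l * U (z i))))
        = ennreal (exp (- l * c) * exp (l * (\<Sum>i<m. U (z i))))"
      by (simp only: prod_ennreal exp_ge_zero ennreal_mult exp_sum[OF finite_lessThan]
          sum_distrib_left prod_nonneg)
    also have "\<dots> = ennreal (exp (l * ((\<Sum>i<m. U (z i)) - c)))"
      by (simp only: exp_add[symmetric] right_diff_distrib) simp
    finally show "(c \<le> (\<Sum>i<m. U (z i)))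
        = (1 \<le> ennreal (exp (- l * c)) * (\<Prod>i<m. ennreal (exp (l * U (z i)))))"
      using l_pos by (simp add: zero_le_mult_iff)
  qed
  also have "\<dots> \<le> ennreal (exp (- l * c))
      * (\<integral>\<^sup>+z. (\<Prod>i<m. ennreal (exp (l * U (z i)))) * indicator (space ?P) z \<partial>?P)"
    by (rule nn_integral_Markov_inequality) auto
  also have "\<dots> \<le> ennreal (exp (- l * c)) * ennreal (exp (m * (l * expectation U + l\<^sup>2 * V)))"
    using moment by (rule mult_left_mono) simp
  also have "\<dots> = ennreal (exp (- l * c + m * (l * expectation U + l\<^sup>2 * V)))"
    by (simp only: ennreal_mult'[symmetric] exp_ge_zero exp_add)
  also have "\<dots> \<le> ennreal (exp (- L))"
    using exponent by (intro ennreal_leI) simp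
  finally have "emeasure ?P {z \<in> space ?P. c \<le> (\<Sum>i<m. U (z i))} \<le> ennreal (exp (- L))" .
  then have "measure ?P {z \<in> space ?P. c \<le> (\<Sum>i<m. U (z i))} \<le> exp (- L)"
    unfolding measure_def by (intro enn2real_leI) auto
  then show ?thesis unfolding c_def .
qed

section \<open>Extended-valued \<open>L\<^sup>p\<close> norms\<close>

lemma powr_convex_combination:
  fixes x y s r :: real
  assumes "0 \<le> x" "0 \<le> y" "0 \<le> s" "s \<le> 1" "1 \<le> r"
  shows "((1 - s) * x + s * y) powr r \<le> (1 - s) * x powr r + s * y powr r"
proof -
  have scale: "(s * y) powr r \<le> s * y powr r" if "0 \<le> y" "0 \<le> s" "s \<le> 1" for s y :: real
  proof -
    have "s powr r \<le> s"
      using powr_mono'[of 1 r s] that \<open>1 \<le> r\<close> by (cases "s = 0") auto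
    then show ?thesis using that by (simp add: powr_mult mult_right_mono)
  qed
  consider "x = 0" | "y = 0" | "0 < x" "0 < y" using assms by linarith
  then show ?thesis
  proof cases
    case 1 then show ?thesis using scale[of y s] assms by simp
  next
    case 2 then show ?thesis using scale[of x "1 - s"] assms by simp
  next
    case 3
    then show ?thesis
      using convex_onD[OF powr_convex[OF \<open>1 \<le> r\<close>], of s x y] assms by simp
  qed
qed

lemma powr_ge_tangent_at_one:
  fixes y r :: real
  assumes "0 \<le> y" "1 \<le> r"
  shows "r * (y - 1) \<le> y powr r - 1"
proof (cases "y = 0")
  case True then show ?thesis using assms by simp
next
  case False
  have "((\<lambda>x. x powr r) has_real_derivative r) (at 1 within {0<..})"
    by (auto intro!: derivative_eq_intros)
  from convex_on_imp_above_tangent[OF powr_convex[OF assms(2)] _ _ _ this, of y]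
  show ?thesis using False assms by (simp add: interior_open)
qed

text \<open>For a positive bound the two roots in the definition of the norm cancel. All later norm estimates
  with a finite exponent go through this modular form, in which Minkowski's inequality is plain
  convexity of the power function.\<close>
lemma Lp_norm_finite_le_iff:
  fixes g :: "'a \<Rightarrow> real" and r a :: real
  assumes g[measurable]: "g \<in> borel_measurable M" and r: "1 \<le> r" and a: "0 < a"
  shows "Lp_norm (ereal r) M (\<lambda>x. ereal (g x)) \<le> ennreal a
     \<longleftrightarrow> (\<integral>\<^sup>+x. ennreal ((\<bar>g x\<bar> / a) powr r) \<partial>M) \<le> 1"
proof -
  define J where "J = (\<integral>\<^sup>+x. ennreal (\<bar>g x\<bar> powr r) \<partial>M)"
  have norm_eq: "Lp_norm (ereal r) M (\<lambda>x. ereal (g x)) = ennreal_powr J (1 / r)"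
    by (simp add: Lp_norm_def J_def ennreal_powr_def)
  have "(\<integral>\<^sup>+x. ennreal ((\<bar>g x\<bar> / a) powr r) \<partial>M)
      = (\<integral>\<^sup>+x. ennreal (1 / a powr r) * ennreal (\<bar>g x\<bar> powr r) \<partial>M)"
    using a by (intro nn_integral_cong) (simp add: powr_divide ennreal_mult'[symmetric])
  also have "\<dots> = ennreal (1 / a powr r) * J"
    unfolding J_def by (rule nn_integral_cmult) simp
  finally have J_scaled: "(\<integral>\<^sup>+x. ennreal ((\<bar>g x\<bar> / a) powr r) \<partial>M) = ennreal (1 / a powr r) * J" .
  show ?thesis
  proof (cases J)
    case top
    then show ?thesis
      using a by (simp add: norm_eq J_scaled ennreal_powr_def ennreal_mult_top top_unique)
  next
    case (real j)
    have "j powr (1 / r) \<le> a \<longleftrightarrow> j \<le> a powr r"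
    proof
      assume "j powr (1 / r) \<le> a"
      then have "(j powr (1 / r)) powr r \<le> a powr r" using r by (intro powr_mono2) auto
      then show "j \<le> a powr r" using r real by (simp add: powr_powr)
    next
      assume "j \<le> a powr r"
      then have "j powr (1 / r) \<le> (a powr r) powr (1 / r)" using r real by (intro powr_mono2) auto
      then show "j powr (1 / r) \<le> a" using r a by (simp add: powr_powr)
    qed
    also have "\<dots> \<longleftrightarrow> 1 / a powr r * j \<le> 1" using a by (simp add: divide_le_eq)
    finally show ?thesis
      using real a by (simp add: norm_eq J_scaled ennreal_powr_def ennreal_mult'[symmetric])
  qed
qed

lemma Lp_norm_infinity_le_iff:
  fixes g :: "'a \<Rightarrow> real"
  assumes g[measurable]: "g \<in> borel_measurable M" and a: "0 \<le> a"
  shows "Lp_norm \<infinity> M (\<lambda>x. ereal (g x)) \<le> ennreal a \<longleftrightarrow> (AE x in M. \<bar>g x\<bar> \<le> a)"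
proof
  assume "Lp_norm \<infinity> M (\<lambda>x. ereal (g x)) \<le> ennreal a"
  then have le: "esssup M (\<lambda>x. ennreal \<bar>g x\<bar>) \<le> ennreal a" by (simp add: Lp_norm_def)
  have "AE x in M. ennreal \<bar>g x\<bar> \<le> esssup M (\<lambda>x. ennreal \<bar>g x\<bar>)" by (rule esssup_AE)
  then show "AE x in M. \<bar>g x\<bar> \<le> a"
  proof eventually_elim
    case (elim x)
    then have "ennreal \<bar>g x\<bar> \<le> ennreal a" using le by (rule order_trans)
    then show ?case using a by simp
  qed
next
  assume *: "AE x in M. \<bar>g x\<bar> \<le> a"
  have "esssup M (\<lambda>x. ennreal \<bar>g x\<bar>) \<le> ennreal a"
    by (rule esssup_I) (use * in \<open>auto elim!: eventually_mono intro: ennreal_leI\<close>)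
  then show "Lp_norm \<infinity> M (\<lambda>x. ereal (g x)) \<le> ennreal a" by (simp add: Lp_norm_def)
qed

lemma Lp_norm_cong:
  assumes "\<And>x. x \<in> space M \<Longrightarrow> f x = g x"
  shows "Lp_norm p M f = Lp_norm p M g"
proof -
  have "(\<lambda>x. e2ennreal \<bar>f x\<bar>) \<in> borel_measurable M \<longleftrightarrow> (\<lambda>x. e2ennreal \<bar>g x\<bar>) \<in> borel_measurable M"
    by (rule measurable_cong) (simp add: assms)
  moreover have "AE x in M. e2ennreal \<bar>f x\<bar> = e2ennreal \<bar>g x\<bar>"
    using assms by (intro AE_I2) simp
  ultimately have "esssup M (\<lambda>x. e2ennreal \<bar>f x\<bar>) = esssup M (\<lambda>x. e2ennreal \<bar>g x\<bar>)"
    unfolding esssup_def by (auto intro: Limsup_eq)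
  moreover have "(\<integral>\<^sup>+x. ennreal_powr (e2ennreal \<bar>f x\<bar>) r \<partial>M) = (\<integral>\<^sup>+x. ennreal_powr (e2ennreal \<bar>g x\<bar>) r \<partial>M)" for r
    using assms by (intro nn_integral_cong) simp
  ultimately show ?thesis by (simp add: Lp_norm_def)
qed

lemma exponent_cases:
  fixes p :: ereal
  assumes "1 \<le> p"
  obtains "p = \<infinity>" | r where "p = ereal r" "1 \<le> r"
  using assms by (cases p) auto

text \<open>With \<open>s = b / (a + b)\<close>, the normalised sum \<open>(\<bar>g\<bar> + \<bar>h\<bar>) / (a + b)\<close> is the convex combination of
  \<open>\<bar>g\<bar> / a\<close> and \<open>\<bar>h\<bar> / b\<close> with weights \<open>1 - s\<close> and \<open>s\<close>, so its modular is at most \<open>1\<close>.\<close>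
lemma Lp_norm_triangle:
  fixes g h k :: "'a \<Rightarrow> real"
  assumes p: "1 \<le> p"
    and [measurable]: "g \<in> borel_measurable M" "h \<in> borel_measurable M" "k \<in> borel_measurable M"
    and ab: "0 < a" "0 < b"
    and g: "Lp_norm p M (\<lambda>x. ereal (g x)) \<le> ennreal a"
    and h: "Lp_norm p M (\<lambda>x. ereal (h x)) \<le> ennreal b"
    and k: "AE x in M. \<bar>k x\<bar> \<le> \<bar>g x\<bar> + \<bar>h x\<bar>"
  shows "Lp_norm p M (\<lambda>x. ereal (k x)) \<le> ennreal (a + b)"
  using p
proof (cases rule: exponent_cases)
  case 1
  then show ?thesis
    using k g h ab by (auto simp: Lp_norm_infinity_le_iff simp del: ennreal_plus)
next
  case (2 r)
  define s where "s = b / (a + b)"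
  have s: "0 \<le> s" "s \<le> 1" "1 - s = a / (a + b)" using ab by (auto simp: s_def field_simps)
  have "(\<integral>\<^sup>+x. ennreal ((\<bar>k x\<bar> / (a + b)) powr r) \<partial>M)
      \<le> (\<integral>\<^sup>+x. ennreal (1 - s) * ennreal ((\<bar>g x\<bar> / a) powr r) + ennreal s * ennreal ((\<bar>h x\<bar> / b) powr r) \<partial>M)"
  proof (rule nn_integral_mono_AE, use k in eventually_elim)
    case (elim x)
    have "\<bar>k x\<bar> / (a + b) \<le> (\<bar>g x\<bar> + \<bar>h x\<bar>) / (a + b)"
      using ab elim by (intro divide_right_mono) auto
    also have "\<dots> = (1 - s) * (\<bar>g x\<bar> / a) + s * (\<bar>h x\<bar> / b)"
      using ab unfolding s(3) by (simp add: s_def add_divide_distrib)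
    finally have "(\<bar>k x\<bar> / (a + b)) powr r \<le> ((1 - s) * (\<bar>g x\<bar> / a) + s * (\<bar>h x\<bar> / b)) powr r"
      using ab 2 by (intro powr_mono2) auto
    also have "\<dots> \<le> (1 - s) * (\<bar>g x\<bar> / a) powr r + s * (\<bar>h x\<bar> / b) powr r"
      using ab 2 s by (intro powr_convex_combination) auto
    finally have "ennreal ((\<bar>k x\<bar> / (a + b)) powr r)
        \<le> ennreal ((1 - s) * (\<bar>g x\<bar> / a) powr r + s * (\<bar>h x\<bar> / b) powr r)" by (rule ennreal_leI)
    then show ?case using s(1,2) by (simp add: ennreal_mult')
  qed
  also have "\<dots> = ennreal (1 - s) * (\<integral>\<^sup>+x. ennreal ((\<bar>g x\<bar> / a) powr r) \<partial>M)
      + ennreal s * (\<integral>\<^sup>+x. ennreal ((\<bar>h x\<bar> / b) powr r) \<partial>M)"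
    by (simp add: nn_integral_add nn_integral_cmult)
  also have "\<dots> \<le> ennreal (1 - s) * 1 + ennreal s * 1"
    using g h ab 2 by (intro add_mono mult_left_mono) (auto simp: Lp_norm_finite_le_iff)
  also have "\<dots> = 1" using s by (simp add: ennreal_plus[symmetric] del: ennreal_plus)
  finally show ?thesis using 2 ab by (simp add: Lp_norm_finite_le_iff del: ennreal_plus)
qed

lemma (in prob_space) Lp_norm_const:
  assumes "1 \<le> p" "0 < c"
  shows "Lp_norm p M (\<lambda>x. ereal c) \<le> ennreal c"
  using assms(1)
proof (cases rule: exponent_cases)
  case 1
  then show ?thesis using assms by (simp add: Lp_norm_infinity_le_iff)
next
  case (2 r)
  then show ?thesis using assms by (simp add: Lp_norm_finite_le_iff emeasure_space_1)
qed

text \<open>Jensen's inequality, in the form that \<open>y \<mapsto> y powr r\<close> lies above its tangent at \<open>1\<close>, applied to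
  \<open>y = \<bar>g x\<bar> / a\<close>.\<close>
lemma (in prob_space) nn_integral_le_Lp_norm:
  fixes g :: "'a \<Rightarrow> real"
  assumes p: "1 \<le> p" and [measurable]: "g \<in> borel_measurable M" and a: "0 < a"
    and g: "Lp_norm p M (\<lambda>x. ereal (g x)) \<le> ennreal a"
  shows "(\<integral>\<^sup>+x. ennreal \<bar>g x\<bar> \<partial>M) \<le> ennreal a"
  using p
proof (cases rule: exponent_cases)
  case 1
  have "(\<integral>\<^sup>+x. ennreal \<bar>g x\<bar> \<partial>M) \<le> (\<integral>\<^sup>+x. ennreal a \<partial>M)"
    by (rule nn_integral_mono_AE)
       (use g 1 a in \<open>auto simp: Lp_norm_infinity_le_iff elim!: eventually_mono intro: ennreal_leI\<close>)
  then show ?thesis by (simp add: emeasure_space_1)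
next
  case (2 r)
  have tangent: "\<bar>g x\<bar> \<le> a * (1 - 1 / r) + a / r * (\<bar>g x\<bar> / a) powr r" for x
  proof -
    have "r * (\<bar>g x\<bar> / a - 1) \<le> (\<bar>g x\<bar> / a) powr r - 1"
      using a 2 by (intro powr_ge_tangent_at_one) auto
    then have "a / r * (r * (\<bar>g x\<bar> / a - 1)) \<le> a / r * ((\<bar>g x\<bar> / a) powr r - 1)"
      using a 2 by (intro mult_left_mono) auto
    then show ?thesis using a 2 by (simp add: algebra_simps)
  qed
  have "(\<integral>\<^sup>+x. ennreal \<bar>g x\<bar> \<partial>M)
      \<le> (\<integral>\<^sup>+x. ennreal (a * (1 - 1 / r)) + ennreal (a / r) * ennreal ((\<bar>g x\<bar> / a) powr r) \<partial>M)"
    using a 2 tangent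
    by (intro nn_integral_mono)
       (simp add: ennreal_mult'[symmetric] ennreal_plus[symmetric] ennreal_leI del: ennreal_plus)
  also have "\<dots> = ennreal (a * (1 - 1 / r)) + ennreal (a / r) * (\<integral>\<^sup>+x. ennreal ((\<bar>g x\<bar> / a) powr r) \<partial>M)"
    by (simp add: nn_integral_add nn_integral_cmult emeasure_space_1)
  also have "\<dots> \<le> ennreal (a * (1 - 1 / r)) + ennreal (a / r) * 1"
    using g a 2 by (intro add_mono mult_left_mono) (auto simp: Lp_norm_finite_le_iff)
  also have "\<dots> = ennreal a"
    using a 2 by (simp add: ennreal_plus[symmetric] field_simps del: ennreal_plus)
  finally show ?thesis .
qed

text \<open>This is where the factor \<open>w_max\<^bsup>1/p\<^esup>\<close> of the theorem comes from: a density bounded by \<open>C\<close>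
  enlarges \<open>\<integral>\<bar>g\<bar>\<^sup>r\<close> by at most \<open>C\<close> and does not enlarge the essential supremum.\<close>
lemma Lp_norm_density_le:
  fixes g :: "'a \<Rightarrow> real"
  assumes p: "1 \<le> p"
    and [measurable]: "w \<in> borel_measurable M" "g \<in> borel_measurable M"
    and w: "\<And>x. x \<in> space M \<Longrightarrow> w x \<le> C" and C: "0 < C"
    and a: "0 < a" and g: "Lp_norm p M (\<lambda>x. ereal (g x)) \<le> ennreal a"
  shows "Lp_norm p (density M (\<lambda>x. ennreal (w x))) (\<lambda>x. ereal (g x)) \<le> ennreal (root_exponent C p * a)"
  using p
proof (cases rule: exponent_cases)
  case 1
  have "AE x in M. \<bar>g x\<bar> \<le> a" using g 1 a by (simp add: Lp_norm_infinity_le_iff)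
  then have "AE x in density M (\<lambda>x. ennreal (w x)). \<bar>g x\<bar> \<le> a"
    by (subst AE_density) (auto elim: eventually_mono)
  then show ?thesis using 1 a by (simp add: Lp_norm_infinity_le_iff root_exponent_def)
next
  case (2 r)
  have pos: "0 < root_exponent C p * a" using C a 2 by (simp add: root_exponent_def)
  have scale: "C * (\<bar>g x\<bar> / (root_exponent C p * a)) powr r = (\<bar>g x\<bar> / a) powr r" for x
    using C a 2 by (simp add: root_exponent_def powr_divide powr_mult powr_powr)
  have "(\<integral>\<^sup>+x. ennreal ((\<bar>g x\<bar> / (root_exponent C p * a)) powr r) \<partial>density M (\<lambda>x. ennreal (w x)))
      = (\<integral>\<^sup>+x. ennreal (w x) * ennreal ((\<bar>g x\<bar> / (root_exponent C p * a)) powr r) \<partial>M)"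
    by (rule nn_integral_density) auto
  also have "\<dots> \<le> (\<integral>\<^sup>+x. ennreal C * ennreal ((\<bar>g x\<bar> / (root_exponent C p * a)) powr r) \<partial>M)"
    using w by (intro nn_integral_mono mult_right_mono ennreal_leI) auto
  also have "\<dots> = (\<integral>\<^sup>+x. ennreal ((\<bar>g x\<bar> / a) powr r) \<partial>M)"
    using C by (simp add: ennreal_mult'[symmetric] scale)
  also have "\<dots> \<le> 1" using g 2 a by (simp add: Lp_norm_finite_le_iff)
  finally show ?thesis using 2 pos by (simp add: Lp_norm_finite_le_iff)
qed

section \<open>Quantiles and interval masses of laws with bounded mass per length\<close>

lemma (in real_distribution) quantile_le_iff:
  assumes "0 < \<tau>" "\<tau> < 1"
  shows "Inf {t. \<tau> \<le> cdf M t} \<le> s \<longleftrightarrow> \<tau> \<le> cdf M s"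
proof -
  interpret cdf_distribution M by unfold_locales
  show ?thesis by (rule pseudoinverse[OF assms, symmetric])
qed

lemma (in real_distribution) measure_interval_eq_cdf:
  assumes lip: "\<And>u v. u \<le> v \<Longrightarrow> measure M {u..v} \<le> c * (v - u)" and uv: "u \<le> v"
  shows "measure M {u..v} = cdf M v - cdf M u"
proof -
  have no_atom: "measure M {u} = 0"
    using lip[of u u] measure_nonneg[of M "{u}"] by simp
  show ?thesis
  proof (cases "u = v")
    case True then show ?thesis using no_atom by simp
  next
    case False
    have "measure M ({u} \<union> {u<..v}) = measure M {u} + measure M {u<..v}"
      by (rule finite_measure_Union) auto
    moreover have "{u} \<union> {u<..v} = {u..v}" using uv by auto
    ultimately have "measure M {u..v} = measure M {u} + measure M {u<..v}" by simp
    then show ?thesis using cdf_diff_eq[of u v] no_atom False uv by simp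
  qed
qed

lemma (in real_distribution) cdf_lipschitz:
  assumes lip: "\<And>u v. u \<le> v \<Longrightarrow> measure M {u..v} \<le> c * (v - u)"
  shows "\<bar>cdf M v - cdf M u\<bar> \<le> c * \<bar>v - u\<bar>"
proof -
  have *: "\<bar>cdf M v - cdf M u\<bar> \<le> c * \<bar>v - u\<bar>" if "u \<le> v" for u v
    using measure_interval_eq_cdf[OF lip that] lip[OF that] measure_nonneg[of M "{u..v}"] that
    by simp
  show ?thesis
    using *[of u v] *[of v u] by (cases "u \<le> v") (simp_all add: abs_minus_commute)
qed

text \<open>A law with bounded mass per length has a continuous distribution function, so the quantile is
  attained with equality.\<close>
lemma (in real_distribution) cdf_quantile:
  assumes lip: "\<And>u v. u \<le> v \<Longrightarrow> measure M {u..v} \<le> c * (v - u)"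
    and \<tau>: "0 < \<tau>" "\<tau> < 1"
  shows "cdf M (Inf {t. \<tau> \<le> cdf M t}) = \<tau>"
proof (rule antisym)
  let ?q = "Inf {t. \<tau> \<le> cdf M t}"
  show "\<tau> \<le> cdf M ?q" using quantile_le_iff[OF \<tau>] by blast
  have c: "0 \<le> c" using order_trans[OF measure_nonneg lip[of 0 1]] by simp
  show "cdf M ?q \<le> \<tau>"
  proof (rule field_le_epsilon)
    fix e :: real assume e: "0 < e"
    define d where "d = e / (c + 1)"
    have d: "0 < d" "c * d \<le> e" using e c by (auto simp: d_def field_simps)
    have "\<not> ?q \<le> ?q - d" using d by simp
    then have "cdf M (?q - d) < \<tau>" by (simp only: quantile_le_iff[OF \<tau>] not_le)
    then show "cdf M ?q \<le> \<tau> + e"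
      using cdf_lipschitz[OF lip, of ?q "?q - d"] d by auto
  qed
qed

text \<open>Sorting is a contraction towards a sorted pair; hence the sorted endpoints inherit the accuracy
  of the raw ones.\<close>
lemma abs_sorted_diff_le:
  fixes a b lo hi :: real
  assumes "lo \<le> hi"
  shows "\<bar>min a b - lo\<bar> + \<bar>max a b - hi\<bar> \<le> \<bar>a - lo\<bar> + \<bar>b - hi\<bar>"
  using assms by (simp add: min_def max_def abs_if)

text \<open>Here \<open>[lo, hi]\<close> is the oracle interval, of mass \<open>\<beta>\<close>, and \<open>[a, b]\<close> an estimate of it. Widening the
  oracle interval by \<open>t\<close> gains mass at least \<open>l * t\<close> at each end, and moving the ends to those of the
  estimate costs at most \<open>c\<close> times the displacement.\<close>
lemma (in real_distribution) widened_interval_mass: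
  fixes lo hi a b t c l \<beta> :: real
  assumes lip: "\<And>u v. u \<le> v \<Longrightarrow> measure M {u..v} \<le> c * (v - u)"
    and ab: "a \<le> b" and lohi: "cdf M hi - cdf M lo = \<beta>" and t: "0 \<le> t"
    and low: "l * t \<le> measure M {lo - t..lo}" and high: "l * t \<le> measure M {hi..hi + t}"
  shows "2 * l * t - c * (\<bar>a - lo\<bar> + \<bar>b - hi\<bar>) \<le> measure M {a - t..b + t} - \<beta>"
proof -
  have "measure M {a - t..b + t} = cdf M (b + t) - cdf M (a - t)"
    using ab t by (intro measure_interval_eq_cdf[OF lip]) auto
  moreover have "cdf M (hi + t) \<le> cdf M (b + t) + c * \<bar>b - hi\<bar>"
    using cdf_lipschitz[OF lip, of "b + t" "hi + t"] by auto
  moreover have "cdf M (a - t) \<le> cdf M (lo - t) + c * \<bar>a - lo\<bar>"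
    using cdf_lipschitz[OF lip, of "a - t" "lo - t"] by auto
  moreover have "l * t \<le> cdf M lo - cdf M (lo - t)" "l * t \<le> cdf M (hi + t) - cdf M hi"
    using low high measure_interval_eq_cdf[OF lip, of "lo - t" lo] measure_interval_eq_cdf[OF lip, of hi "hi + t"]
      t by auto
  ultimately show ?thesis using lohi by (simp add: algebra_simps)
qed

text \<open>The counterpart for narrowing. If \<open>a + t > b - t\<close>, the interval is empty, and the bound holds
  because \<open>2 * l * t\<close> does not exceed the oracle mass \<open>\<beta>\<close>.\<close>
lemma (in real_distribution) narrowed_interval_mass:
  fixes lo hi a b t c l \<beta> :: real
  assumes lip: "\<And>u v. u \<le> v \<Longrightarrow> measure M {u..v} \<le> c * (v - u)" and c: "0 \<le> c"
    and lohi: "cdf M hi - cdf M lo = \<beta>" and t: "0 \<le> t" "2 * l * t \<le> \<beta>"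
    and low: "l * t \<le> measure M {lo..lo + t}" and high: "l * t \<le> measure M {hi - t..hi}"
  shows "measure M {a + t..b - t} - \<beta> \<le> - (2 * l * t - c * (\<bar>a - lo\<bar> + \<bar>b - hi\<bar>))"
proof (cases "a + t \<le> b - t")
  case True
  then have "measure M {a + t..b - t} = cdf M (b - t) - cdf M (a + t)"
    by (intro measure_interval_eq_cdf[OF lip]) auto
  moreover have "cdf M (b - t) \<le> cdf M (hi - t) + c * \<bar>b - hi\<bar>"
    using cdf_lipschitz[OF lip, of "b - t" "hi - t"] by auto
  moreover have "cdf M (lo + t) \<le> cdf M (a + t) + c * \<bar>a - lo\<bar>"
    using cdf_lipschitz[OF lip, of "a + t" "lo + t"] by auto
  moreover have "l * t \<le> cdf M (lo + t) - cdf M lo" "l * t \<le> cdf M hi - cdf M (hi - t)"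
    using low high measure_interval_eq_cdf[OF lip, of lo "lo + t"] measure_interval_eq_cdf[OF lip, of "hi - t" hi]
      t by auto
  ultimately show ?thesis using lohi by (simp add: algebra_simps)
next
  case False
  moreover have "0 \<le> c * (\<bar>a - lo\<bar> + \<bar>b - hi\<bar>)" using c by simp
  ultimately show ?thesis using t by simp
qed

lemma real_distribution_kernel:
  assumes "K \<in> M \<rightarrow>\<^sub>M prob_algebra borel" "x \<in> space M"
  shows "real_distribution (K x)"
proof -
  have "K x \<in> space (prob_algebra borel)" using assms by (rule measurable_space)
  then have "prob_space (K x)" "sets (K x) = sets borel" by (auto simp: space_prob_algebra)
  then show ?thesis
    using sets_eq_imp_space_eq[of "K x" borel]
    by (simp add: real_distribution_def real_distribution_axioms_def)
qed

lemma cond_quantile_eq: "cond_quantile K \<tau> x = Inf {t. \<tau> \<le> cdf (K x) t}"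
  by (simp add: cond_quantile_def cdf_def)

lemma measurable_cond_quantile:
  assumes K[measurable]: "K \<in> M \<rightarrow>\<^sub>M prob_algebra borel" and \<tau>: "0 < \<tau>" "\<tau> < 1"
  shows "cond_quantile K \<tau> \<in> borel_measurable M"
proof (rule borel_measurableI_le)
  fix s
  have [measurable]: "K \<in> M \<rightarrow>\<^sub>M subprob_algebra borel" using K by (rule measurable_prob_algebraD)
  have "(\<lambda>x. measure (K x) {..s}) \<in> borel_measurable M" by measurable
  then have [measurable]: "(\<lambda>x. cdf (K x) s) \<in> borel_measurable M" by (simp add: cdf_def)
  have "{x \<in> space M. cond_quantile K \<tau> x \<le> s} = {x \<in> space M. \<tau> \<le> cdf (K x) s}"
    by (simp only: cond_quantile_eq real_distribution.quantile_le_iff[OF real_distribution_kernel[OF K] \<tau>]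
        cong: conj_cong)
  also have "\<dots> \<in> sets M" by measurable
  finally show "{x \<in> space M. cond_quantile K \<tau> x \<le> s} \<in> sets M" .
qed

section \<open>The weighted threshold\<close>

lemma score_le_iff:
  "score \<alpha> g x y \<le> s \<longleftrightarrow> y \<in> {lower_endpoint \<alpha> g x - s..upper_endpoint \<alpha> g x + s}"
  by (auto simp: score_def)

lemma measure_weighted_score_law:
  assumes w: "\<And>i. i < m \<Longrightarrow> 0 \<le> w (fst (D i))" "0 \<le> w x"
  shows "measure (weighted_score_law \<alpha> w g m D x) {..ereal s}
     = (\<Sum>j<m. w (fst (D j)) * of_bool (score \<alpha> g (fst (D j)) (snd (D j)) \<le> s))
       / ((\<Sum>i<m. w (fst (D i))) + w x)"
proof -
  define W where "W = (\<Sum>i<m. w (fst (D i))) + w x"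
  define v where "v j = (if j < m then w (fst (D j)) else w x) / W" for j
  define S where "S j = (if j < m then ereal (score \<alpha> g (fst (D j)) (snd (D j))) else \<infinity>)" for j
  have W: "0 \<le> W" unfolding W_def using w by (intro add_nonneg_nonneg sum_nonneg) auto
  have v: "0 \<le> v j" for j using w W by (simp add: v_def)
  have "measure (weighted_score_law \<alpha> w g m D x) {..ereal s}
      = measure (distr (point_measure {..m} (\<lambda>j. ennreal (v j))) borel S) {..ereal s}"
    by (simp add: weighted_score_law_def v_def[abs_def] S_def[abs_def] W_def)
  also have "\<dots> = measure (point_measure {..m} (\<lambda>j. ennreal (v j))) (S -` {..ereal s} \<inter> {..m})"
    by (subst measure_distr) (auto simp: measurable_def space_point_measure sets_point_measure)
  also have "\<dots> = (\<Sum>j\<in>S -` {..ereal s} \<inter> {..m}. v j)"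
    using measure_point_measure_finite_if[of "{..m}" v "S -` {..ereal s} \<inter> {..m}"] v by simp
  also have "\<dots> = (\<Sum>j\<in>{j\<in>{..<m}. score \<alpha> g (fst (D j)) (snd (D j)) \<le> s}. v j)"
    by (intro sum.cong) (auto simp: S_def split: if_splits)
  also have "\<dots> = (\<Sum>j<m. v j * of_bool (score \<alpha> g (fst (D j)) (snd (D j)) \<le> s))"
    unfolding sum.inter_filter[OF finite_lessThan] by (intro sum.cong) auto
  also have "\<dots> = (\<Sum>j<m. w (fst (D j)) * of_bool (score \<alpha> g (fst (D j)) (snd (D j)) \<le> s)) / W"
    unfolding sum_divide_distrib by (intro sum.cong) (auto simp: v_def)
  finally show ?thesis by (simp add: W_def)
qed

text \<open>The weight of the test point enters the score law only through the total mass, where it competes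
  against the calibration scores. Replacing it by its upper bound \<open>C\<close> gives one condition on the
  calibration sample that serves all test points at once.\<close>
lemma weighted_threshold_le:
  assumes w: "\<And>i. i < m \<Longrightarrow> 0 \<le> w (fst (D i))" "0 \<le> w x" "w x \<le> C" and C: "0 < C" and \<alpha>: "\<alpha> < 1"
    and mass: "(1 - \<alpha>) * ((\<Sum>i<m. w (fst (D i))) + C)
       \<le> (\<Sum>j<m. w (fst (D j)) * of_bool (score \<alpha> g (fst (D j)) (snd (D j)) \<le> t))"
  shows "weighted_threshold \<alpha> w g m D x \<le> ereal t"
proof -
  let ?W = "\<Sum>i<m. w (fst (D i))"
  let ?F = "\<Sum>j<m. w (fst (D j)) * of_bool (score \<alpha> g (fst (D j)) (snd (D j)) \<le> t)"
  have W: "0 \<le> ?W" using w by (intro sum_nonneg) auto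
  have "?F \<le> ?W" using w by (intro sum_mono) auto
  moreover have "0 < (1 - \<alpha>) * (?W + C)" using W C \<alpha> by simp
  ultimately have W_pos: "0 < ?W + w x" using mass w by linarith
  have "(1 - \<alpha>) * (?W + w x) \<le> (1 - \<alpha>) * (?W + C)" using w \<alpha> by (intro mult_left_mono) auto
  then have "1 - \<alpha> \<le> ?F / (?W + w x)" using mass W_pos by (simp add: le_divide_eq)
  then have "1 - \<alpha> \<le> measure (weighted_score_law \<alpha> w g m D x) {..ereal t}"
    using w by (simp add: measure_weighted_score_law)
  then show ?thesis unfolding weighted_threshold_def ereal_quantile_def by (intro Inf_lower) auto
qed

text \<open>For the lower bound the worst test point is one of weight \<open>0\<close>, again a condition that does not
  mention \<open>x\<close>.\<close>
lemma weighted_threshold_ge: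
  assumes w: "\<And>i. i < m \<Longrightarrow> 0 \<le> w (fst (D i))" "0 \<le> w x" and \<alpha>: "\<alpha> < 1"
    and mass: "(\<Sum>j<m. w (fst (D j)) * of_bool (score \<alpha> g (fst (D j)) (snd (D j)) \<le> s))
       < (1 - \<alpha>) * (\<Sum>i<m. w (fst (D i)))"
  shows "ereal s \<le> weighted_threshold \<alpha> w g m D x"
  unfolding weighted_threshold_def ereal_quantile_def
proof (rule Inf_greatest, clarsimp)
  fix u
  let ?W = "\<Sum>i<m. w (fst (D i))"
  let ?F = "\<lambda>s. \<Sum>j<m. w (fst (D j)) * of_bool (score \<alpha> g (fst (D j)) (snd (D j)) \<le> s)"
  assume u: "1 - \<alpha> \<le> measure (weighted_score_law \<alpha> w g m D x) {..ereal u}"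
  have F_nonneg: "0 \<le> ?F s" using w by (intro sum_nonneg) auto
  then have W: "0 < ?W" using mass \<alpha> by (smt (verit) zero_less_mult_pos)
  show "s \<le> u"
  proof (rule ccontr)
    assume "\<not> s \<le> u"
    then have "?F u \<le> ?F s" using w by (intro sum_mono mult_left_mono) auto
    moreover have "1 - \<alpha> \<le> ?F u / (?W + w x)"
      using u w by (simp add: measure_weighted_score_law)
    moreover have "(1 - \<alpha>) * ?W \<le> (1 - \<alpha>) * (?W + w x)" using w \<alpha> by (intro mult_left_mono) auto
    ultimately show False using mass W w by (simp add: le_divide_eq)
  qed
qed

text \<open>The essential supremum of a non-measurable function is \<open>\<infinity>\<close> by convention, so for \<open>p = \<infinity>\<close> the
  measurability of the threshold in \<open>x\<close> is part of the claim. By monotonicity in \<open>s\<close> the infimum may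
  be tested on rational \<open>s\<close>.\<close>
lemma measurable_weighted_threshold:
  assumes w[measurable]: "w \<in> borel_measurable M" and nonneg: "\<And>x. x \<in> space M \<Longrightarrow> 0 \<le> w x"
    and D: "\<And>i. i < m \<Longrightarrow> fst (D i) \<in> space M"
  shows "weighted_threshold \<alpha> w g m D \<in> borel_measurable M"
proof (rule borel_measurableI_less)
  fix c
  let ?F = "\<lambda>x s. (\<Sum>j<m. w (fst (D j)) * of_bool (score \<alpha> g (fst (D j)) (snd (D j)) \<le> s))
       / ((\<Sum>i<m. w (fst (D i))) + w x)"
  have F_mono: "?F x s \<le> ?F x t" if "s \<le> t" "x \<in> space M" for x s t
    using that nonneg D
    by (intro divide_right_mono sum_mono mult_left_mono add_nonneg_nonneg sum_nonneg) auto
  have "(weighted_threshold \<alpha> w g m D x < c) = (\<exists>q::rat. ereal (real_of_rat q) < c \<and> 1 - \<alpha> \<le> ?F x (real_of_rat q))"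
    if x: "x \<in> space M" for x
  proof -
    have "weighted_threshold \<alpha> w g m D x = Inf {ereal t | t. 1 - \<alpha> \<le> ?F x t}"
      unfolding weighted_threshold_def ereal_quantile_def
      using x nonneg D by (simp add: measure_weighted_score_law)
    then have "(weighted_threshold \<alpha> w g m D x < c) = (\<exists>t. ereal t < c \<and> 1 - \<alpha> \<le> ?F x t)"
      by (auto simp: Inf_less_iff)
    also have "\<dots> = (\<exists>q::rat. ereal (real_of_rat q) < c \<and> 1 - \<alpha> \<le> ?F x (real_of_rat q))"
    proof safe
      fix t assume t: "ereal t < c" "1 - \<alpha> \<le> ?F x t"
      obtain b where b: "t < b" "ereal b < c"
        using ereal_dense2[OF t(1)] by auto
      obtain q where q: "t < real_of_rat q" "real_of_rat q < b" using of_rat_dense[OF b(1)] by blast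
      have "ereal (real_of_rat q) < ereal b" using q by simp
      also note b(2)
      finally show "\<exists>q::rat. ereal (real_of_rat q) < c \<and> 1 - \<alpha> \<le> ?F x (real_of_rat q)"
        using q t F_mono[of t "real_of_rat q" x] x by (intro exI[of _ q]) auto
    qed auto
    finally show ?thesis .
  qed
  then have "{x \<in> space M. weighted_threshold \<alpha> w g m D x < c}
      = {x \<in> space M. \<exists>q::rat. ereal (real_of_rat q) < c \<and> 1 - \<alpha> \<le> ?F x (real_of_rat q)}"
    by auto
  also have "\<dots> \<in> sets M" by measurable
  finally show "{x \<in> space M. weighted_threshold \<alpha> w g m D x < c} \<in> sets M" .
qed

lemma len_interval: "len {a..b} = ereal (max 0 (b - a))"
  by (cases "a \<le> b") (auto simp: len_def enn2ereal_ennreal max_def zero_ennreal.rep_eq)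

lemma weighted_cqr_set_eq:
  assumes "weighted_threshold \<alpha> w g m D x = ereal q"
  shows "weighted_cqr_set \<alpha> w g m D x = {lower_endpoint \<alpha> g x - q..upper_endpoint \<alpha> g x + q}"
  using assms by (auto simp: weighted_cqr_set_def score_le_iff)

section \<open>Joint laws and samples\<close>

lemma joint_law_kernel:
  assumes K[measurable]: "K \<in> PX \<rightarrow>\<^sub>M prob_algebra borel"
  shows "(\<lambda>x. K x \<bind> (\<lambda>y. return (PX \<Otimes>\<^sub>M borel) (x, y))) \<in> PX \<rightarrow>\<^sub>M prob_algebra (PX \<Otimes>\<^sub>M borel)"
  by measurable

lemma
  assumes PX: "prob_space PX" and K: "K \<in> PX \<rightarrow>\<^sub>M prob_algebra borel"
  shows sets_joint_law: "sets (joint_law PX K) = sets (PX \<Otimes>\<^sub>M borel)"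
    and prob_space_joint_law: "prob_space (joint_law PX K)"
proof -
  have PX': "PX \<in> space (prob_algebra PX)" using PX by (simp add: space_prob_algebra)
  show "sets (joint_law PX K) = sets (PX \<Otimes>\<^sub>M borel)"
    unfolding joint_law_def by (rule sets_bind'[OF PX' joint_law_kernel[OF K]])
  show "prob_space (joint_law PX K)"
    unfolding joint_law_def by (rule prob_space_bind'[OF PX' joint_law_kernel[OF K]])
qed

lemma integral_joint_law:
  fixes f :: "'x \<times> real \<Rightarrow> real"
  assumes PX: "prob_space PX" and K: "K \<in> PX \<rightarrow>\<^sub>M prob_algebra borel"
    and f[measurable]: "f \<in> borel_measurable (PX \<Otimes>\<^sub>M borel)"
    and bound: "\<And>z. z \<in> space (PX \<Otimes>\<^sub>M borel) \<Longrightarrow> \<bar>f z\<bar> \<le> B"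
  shows "(\<integral>z. f z \<partial>joint_law PX K) = (\<integral>x. \<integral>y. f (x, y) \<partial>K x \<partial>PX)"
proof -
  interpret prob_space PX by fact
  note k = joint_law_kernel[OF K]
  have "(\<integral>z. f z \<partial>joint_law PX K)
      = (\<integral>x. \<integral>z. f z \<partial>(K x \<bind> (\<lambda>y. return (PX \<Otimes>\<^sub>M borel) (x, y))) \<partial>PX)"
    unfolding joint_law_def
  proof (rule integral_bind[OF f bound])
    show "finite_measure PX" by unfold_locales
    show "(\<lambda>x. K x \<bind> (\<lambda>y. return (PX \<Otimes>\<^sub>M borel) (x, y))) \<in> PX \<rightarrow>\<^sub>M subprob_algebra (PX \<Otimes>\<^sub>M borel)"
      using k by (rule measurable_prob_algebraD)
    show "AE x in PX. emeasure (K x \<bind> (\<lambda>y. return (PX \<Otimes>\<^sub>M borel) (x, y)))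
        (space (K x \<bind> (\<lambda>y. return (PX \<Otimes>\<^sub>M borel) (x, y)))) \<le> ennreal 1"
    proof (rule AE_I2)
      fix x assume "x \<in> space PX"
      then interpret Kx: prob_space "K x \<bind> (\<lambda>y. return (PX \<Otimes>\<^sub>M borel) (x, y))"
        using measurable_space[OF k] by (auto simp: space_prob_algebra)
      show "emeasure (K x \<bind> (\<lambda>y. return (PX \<Otimes>\<^sub>M borel) (x, y)))
        (space (K x \<bind> (\<lambda>y. return (PX \<Otimes>\<^sub>M borel) (x, y)))) \<le> ennreal 1"
        using Kx.emeasure_space_1 by simp
    qed
  qed
  also have "\<dots> = (\<integral>x. \<integral>y. f (x, y) \<partial>K x \<partial>PX)"
  proof (rule Bochner_Integration.integral_cong[OF refl])
    fix x assume x: "x \<in> space PX"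
    have Kx: "prob_space (K x)" "sets (K x) = sets borel"
      using measurable_space[OF K x] by (auto simp: space_prob_algebra)
    have ne: "space (K x) \<noteq> {}" using Kx(1) by (rule prob_space.not_empty)
    have pair: "Pair x \<in> K x \<rightarrow>\<^sub>M PX \<Otimes>\<^sub>M borel"
      using x by (subst measurable_cong_sets[OF Kx(2) refl]) simp
    have "K x \<bind> (\<lambda>y. return (PX \<Otimes>\<^sub>M borel) (x, y)) = distr (K x) (PX \<Otimes>\<^sub>M borel) (Pair x)"
      using bind_return_distr'[OF ne pair] .
    then show "(\<integral>z. f z \<partial>(K x \<bind> (\<lambda>y. return (PX \<Otimes>\<^sub>M borel) (x, y)))) = (\<integral>y. f (x, y) \<partial>K x)"
      by (simp add: integral_distr[OF pair f])
  qed
  finally show ?thesis .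
qed

text \<open>Integrates a pointwise lower bound \<open>k - c * d\<close> against a probability density \<open>w\<close>, when \<open>d\<close> is
  only known to have mean at most \<open>D\<close> under that density; \<open>u\<close> will be an excess of coverage and \<open>d\<close>
  the endpoint error.\<close>
lemma (in prob_space) weighted_integral_lower_bound:
  fixes w d u :: "'a \<Rightarrow> real"
  assumes [measurable]: "w \<in> borel_measurable M" "d \<in> borel_measurable M" "u \<in> borel_measurable M"
    and w: "\<And>x. x \<in> space M \<Longrightarrow> 0 \<le> w x \<and> w x \<le> C" and w_int: "(\<integral>x. w x \<partial>M) = 1"
    and u: "\<And>x. x \<in> space M \<Longrightarrow> \<bar>u x\<bar> \<le> B"
    and d: "\<And>x. 0 \<le> d x" and d_int: "(\<integral>\<^sup>+x. ennreal (d x) \<partial>density M (\<lambda>x. ennreal (w x))) \<le> ennreal D"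
    and D: "0 \<le> D" and c: "0 \<le> c"
    and le: "AE x in M. k - c * d x \<le> u x"
  shows "k - c * D \<le> (\<integral>x. w x * u x \<partial>M)"
proof -
  have wd_nn: "(\<integral>\<^sup>+x. ennreal (w x * d x) \<partial>M) \<le> ennreal D"
  proof -
    have "(\<integral>\<^sup>+x. ennreal (w x * d x) \<partial>M) = (\<integral>\<^sup>+x. ennreal (w x) * ennreal (d x) \<partial>M)"
      using w d by (intro nn_integral_cong) (simp add: ennreal_mult)
    also have "\<dots> = (\<integral>\<^sup>+x. ennreal (d x) \<partial>density M (\<lambda>x. ennreal (w x)))"
      by (rule nn_integral_density[symmetric]) auto
    finally show ?thesis using d_int by simp
  qed
  have wd_nonneg: "AE x in M. 0 \<le> w x * d x" using w d by (intro AE_I2) auto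
  have int_wd: "integrable M (\<lambda>x. w x * d x)"
    by (rule integrableI_nonneg[OF _ wd_nonneg])
       (use wd_nn in \<open>auto intro: le_less_trans[OF _ ennreal_less_top]\<close>)
  have "ennreal (\<integral>x. w x * d x \<partial>M) \<le> ennreal D"
    using nn_integral_eq_integral[OF int_wd wd_nonneg] wd_nn by simp
  then have wd: "(\<integral>x. w x * d x \<partial>M) \<le> D" using D by simp
  have int_w: "integrable M w"
    by (rule integrable_const_bound[where B=C]) (use w in auto)
  have int_wu: "integrable M (\<lambda>x. w x * u x)"
  proof (rule integrable_const_bound[where B="C * B"])
    show "AE x in M. norm (w x * u x) \<le> C * B"
      using w u by (intro AE_I2) (auto simp: abs_mult intro!: mult_mono intro: order_trans)
  qed simp
  have "k - c * D \<le> k * (\<integral>x. w x \<partial>M) - c * (\<integral>x. w x * d x \<partial>M)"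
    using wd c w_int by (simp add: mult_left_mono)
  also have "\<dots> = (\<integral>x. k * w x - c * (w x * d x) \<partial>M)"
    using int_w int_wd by simp
  also have "\<dots> \<le> (\<integral>x. w x * u x \<partial>M)"
  proof (rule integral_mono_AE)
    show "AE x in M. k * w x - c * (w x * d x) \<le> w x * u x"
      using le AE_space
    proof eventually_elim
      case (elim x)
      then have "w x * (k - c * d x) \<le> w x * u x" using w by (intro mult_left_mono) auto
      then show ?case by (simp add: algebra_simps)
    qed
  qed (use int_w int_wd int_wu in auto)
  finally show ?thesis .
qed

lemma prob_space_sample_law:
  assumes "prob_space PX" "K \<in> PX \<rightarrow>\<^sub>M prob_algebra borel"
  shows "prob_space (sample_law PX K n)"
  unfolding sample_law_def by (intro prob_space_PiM prob_space_joint_law assms)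

lemma sample_component:
  assumes "prob_space PX" "K \<in> PX \<rightarrow>\<^sub>M prob_algebra borel" "i < n"
  shows "(\<lambda>D. D i) \<in> sample_law PX K n \<rightarrow>\<^sub>M PX \<Otimes>\<^sub>M borel"
proof -
  have "(\<lambda>D. D i) \<in> sample_law PX K n \<rightarrow>\<^sub>M joint_law PX K"
    unfolding sample_law_def using assms(3) by (intro measurable_component_singleton) auto
  then show ?thesis
    using measurable_cong_sets[OF refl sets_joint_law[OF assms(1,2)]] by blast
qed

text \<open>Fubini in the form used for an event that conditions on the training sample lying in \<open>T\<close> and,
  given it, on the independent calibration sample.\<close>
lemma product_prob_ge:
  assumes N: "prob_space N" and M: "prob_space M" and B: "B \<in> sets (N \<Otimes>\<^sub>M M)" and T: "T \<in> sets N"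
    and a: "0 \<le> a" "a \<le> measure N T" and b: "0 \<le> b"
    and section_ge: "\<And>x. x \<in> T \<Longrightarrow> b \<le> measure M (Pair x -` B)"
  shows "a * b \<le> measure (N \<Otimes>\<^sub>M M) B"
proof -
  interpret N: prob_space N by fact
  interpret M: prob_space M by fact
  interpret pair_prob_space N M ..
  have "ennreal (a * b) = ennreal b * ennreal a" using a b by (simp add: ennreal_mult' mult.commute)
  also have "\<dots> \<le> ennreal b * emeasure N T"
    using a by (intro mult_left_mono) (auto simp: N.emeasure_eq_measure)
  also have "\<dots> = (\<integral>\<^sup>+x. ennreal b * indicator T x \<partial>N)" using T by (simp add: nn_integral_cmult_indicator)
  also have "\<dots> \<le> (\<integral>\<^sup>+x. emeasure M (Pair x -` B) \<partial>N)"
    using section_ge by (intro nn_integral_mono) (auto simp: M.emeasure_eq_measure split: split_indicator)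
  also have "\<dots> = emeasure (N \<Otimes>\<^sub>M M) B" using B by (rule M.emeasure_pair_measure_alt[symmetric])
  finally show ?thesis by (simp add: P.emeasure_eq_measure)
qed

section \<open>Coverage of the fitted interval under covariate shift\<close>

locale covariate_shift_regression =
  fixes PX QX :: "'x measure" and K :: "'x \<Rightarrow> real measure" and w :: "'x \<Rightarrow> real"
    and \<alpha> \<mu>_low \<mu>_up r0 w_max :: real
  assumes PX: "prob_space PX"
    and K: "K \<in> PX \<rightarrow>\<^sub>M prob_algebra borel"
    and \<alpha>: "0 < \<alpha>" "\<alpha> < 1"
    and regular: "mass_regularity PX K \<alpha> \<mu>_low \<mu>_up r0"
    and shift: "covariate_shift PX QX w w_max"
begin

sublocale PX: prob_space PX by (rule PX)
sublocale QX: prob_space QX using shift unfolding covariate_shift_def by blast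
sublocale joint: prob_space "joint_law PX K" by (rule prob_space_joint_law[OF PX K])

abbreviation (input) q_lo where "q_lo \<equiv> cond_quantile K (\<alpha> / 2)"
abbreviation (input) q_hi where "q_hi \<equiv> cond_quantile K (1 - \<alpha> / 2)"

lemma w_measurable[measurable]: "w \<in> borel_measurable PX"
  and w_bounds: "x \<in> space PX \<Longrightarrow> 0 \<le> w x \<and> w x \<le> w_max"
  and QX_eq: "QX = density PX (\<lambda>x. ennreal (w x))"
  using shift unfolding covariate_shift_def by blast+

lemma sets_QX[measurable_cong, simp]: "sets QX = sets PX"
  by (simp add: QX_eq)

lemma space_QX[simp]: "space QX = space PX"
  by (simp add: QX_eq)

lemma \<mu>_pos: "0 < \<mu>_low" "\<mu>_low \<le> \<mu>_up" "0 < \<mu>_up"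
  using regular by (auto simp: mass_regularity_def)

lemma q_measurable[measurable]: "q_lo \<in> borel_measurable PX" "q_hi \<in> borel_measurable PX"
  using \<alpha> by (auto intro!: measurable_cond_quantile[OF K])

lemma integrable_w: "integrable PX w"
  by (rule PX.integrable_const_bound[where B=w_max]) (use w_bounds in auto)

lemma integral_w: "(\<integral>x. w x \<partial>PX) = 1"
proof -
  have nonneg: "AE x in PX. 0 \<le> w x" using w_bounds by auto
  have "ennreal (\<integral>x. w x \<partial>PX) = (\<integral>\<^sup>+x. ennreal (w x) \<partial>PX)"
    using nn_integral_eq_integral[OF integrable_w nonneg] by simp
  also have "\<dots> = emeasure QX (space PX)" by (simp add: QX_eq emeasure_density cong: nn_integral_cong)
  also have "\<dots> = 1" using QX.emeasure_space_1 by simp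
  finally show ?thesis by simp
qed

lemma w_max_ge_1: "1 \<le> w_max"
proof -
  have "(\<integral>x. w x \<partial>PX) \<le> (\<integral>x. w_max \<partial>PX)"
    using w_bounds by (intro integral_mono integrable_w) auto
  then show ?thesis by (simp add: integral_w PX.prob_space)
qed

lemma chi_square_eq: "1 + chi_square PX w = (\<integral>x. (w x)\<^sup>2 \<partial>PX)"
proof -
  have int: "integrable PX (\<lambda>x. (w x)\<^sup>2)"
    by (rule PX.integrable_const_bound[where B="w_max\<^sup>2"]) (use w_bounds in \<open>auto intro!: power_mono\<close>)
  have "chi_square PX w = (\<integral>x. (w x)\<^sup>2 - 2 * w x + 1 \<partial>PX)"
    unfolding chi_square_def by (simp add: power2_eq_square algebra_simps)
  also have "\<dots> = (\<integral>x. (w x)\<^sup>2 \<partial>PX) - 2 * (\<integral>x. w x \<partial>PX) + 1"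
    using int integrable_w by (simp add: PX.prob_space)
  finally show ?thesis by (simp add: integral_w)
qed

lemma chi_square_nonneg: "0 \<le> chi_square PX w"
  unfolding chi_square_def by (rule integral_nonneg_AE) simp

definition endpoint_error :: "(real \<Rightarrow> 'x \<Rightarrow> real) \<Rightarrow> 'x \<Rightarrow> real" where
  "endpoint_error g x = \<bar>g (\<alpha> / 2) x - q_lo x\<bar> + \<bar>g (1 - \<alpha> / 2) x - q_hi x\<bar>"

text \<open>Up to this bound the mass regularity controls both the widened and the narrowed interval.\<close>
definition admissible_widening :: "real \<Rightarrow> bool" where
  "admissible_widening t \<longleftrightarrow> 0 \<le> t \<and> t \<le> r_minus r0 \<alpha> \<mu>_up"

text \<open>Everything that the rest of the argument uses about the conditional laws. It combines the two
  interval lemmas, for the oracle mass \<open>1 - \<alpha>\<close>, with the fact that sorting does not increase the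
  endpoint error.\<close>
lemma AE_regular:
  "AE x in PX. q_lo x \<le> q_hi x \<and> (\<forall>g t. admissible_widening t \<longrightarrow>
      2 * \<mu>_low * t - \<mu>_up * endpoint_error g x
        \<le> measure (K x) {lower_endpoint \<alpha> g x - t..upper_endpoint \<alpha> g x + t} - (1 - \<alpha>) \<and>
      measure (K x) {lower_endpoint \<alpha> g x + t..upper_endpoint \<alpha> g x - t} - (1 - \<alpha>)
        \<le> - (2 * \<mu>_low * t - \<mu>_up * endpoint_error g x))"
proof -
  obtain X0 where X0: "X0 \<in> sets PX" "measure PX X0 = 1"
    and raw: "\<forall>x\<in>X0.
           (\<forall>u v. u \<le> v \<longrightarrow> measure (K x) {u..v} \<le> \<mu>_up * (v - u)) \<and>
           (\<forall>\<tau>\<in>{\<alpha>/2, 1 - \<alpha>/2}. \<forall>h. 0 \<le> h \<and> h \<le> r0 \<longrightarrow>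
              \<mu>_low * h \<le> measure (K x) {cond_quantile K \<tau> x - h .. cond_quantile K \<tau> x} \<and>
              \<mu>_low * h \<le> measure (K x) {cond_quantile K \<tau> x .. cond_quantile K \<tau> x + h})"
    using regular unfolding mass_regularity_def by (elim conjE bexE) (rule that)
  have "AE x in PX. x \<in> X0" using X0 by (simp add: PX.prob_eq_1)
  then show ?thesis using AE_space
  proof eventually_elim
    case (elim x)
    interpret Kx: real_distribution "K x" by (rule real_distribution_kernel[OF K elim(2)])
    have lip: "measure (K x) {u..v} \<le> \<mu>_up * (v - u)" if "u \<le> v" for u v
      using raw elim(1) that by blast
    have near: "\<mu>_low * h \<le> measure (K x) {cond_quantile K \<tau> x - h .. cond_quantile K \<tau> x}"
        "\<mu>_low * h \<le> measure (K x) {cond_quantile K \<tau> x .. cond_quantile K \<tau> x + h}"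
      if "\<tau> \<in> {\<alpha> / 2, 1 - \<alpha> / 2}" "0 \<le> h" "h \<le> r0" for \<tau> h
      using bspec[OF bspec[OF raw elim(1), THEN conjunct2] that(1)] that(2,3) by auto
    have cdf: "cdf (K x) (q_lo x) = \<alpha> / 2" "cdf (K x) (q_hi x) = 1 - \<alpha> / 2"
      using Kx.cdf_quantile[OF lip, of "\<alpha> / 2"] Kx.cdf_quantile[OF lip, of "1 - \<alpha> / 2"] \<alpha>
      by (simp_all add: cond_quantile_eq)
    have le: "q_lo x \<le> q_hi x"
    proof (rule ccontr)
      assume "\<not> q_lo x \<le> q_hi x"
      then have "cdf (K x) (q_hi x) \<le> cdf (K x) (q_lo x)" by (intro Kx.cdf_nondecreasing) simp
      then show False using cdf \<alpha> by simp
    qed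
    show ?case
    proof (intro conjI allI impI le)
      fix g t assume "admissible_widening t"
      then have t: "0 \<le> t" "t \<le> r0" "t \<le> (1 - \<alpha>) / (2 * \<mu>_up)"
        by (auto simp: admissible_widening_def r_minus_def)
      have "2 * \<mu>_low * t \<le> 2 * \<mu>_up * t" using \<mu>_pos t by (intro mult_right_mono) auto
      also have "\<dots> \<le> 1 - \<alpha>" using t(3) \<mu>_pos by (simp add: field_simps)
      finally have fits: "2 * \<mu>_low * t \<le> 1 - \<alpha>" .
      define a where "a = lower_endpoint \<alpha> g x"
      define b where "b = upper_endpoint \<alpha> g x"
      have ab: "a \<le> b" by (simp add: a_def b_def lower_endpoint_def upper_endpoint_def)
      have "\<bar>a - q_lo x\<bar> + \<bar>b - q_hi x\<bar> \<le> endpoint_error g x"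
        using abs_sorted_diff_le[OF le]
        by (simp add: a_def b_def lower_endpoint_def upper_endpoint_def endpoint_error_def)
      then have err: "\<mu>_up * (\<bar>a - q_lo x\<bar> + \<bar>b - q_hi x\<bar>) \<le> \<mu>_up * endpoint_error g x"
        using \<mu>_pos by (intro mult_left_mono) auto
      have lohi: "cdf (K x) (q_hi x) - cdf (K x) (q_lo x) = 1 - \<alpha>" using cdf by simp
      have "2 * \<mu>_low * t - \<mu>_up * (\<bar>a - q_lo x\<bar> + \<bar>b - q_hi x\<bar>)
          \<le> measure (K x) {a - t..b + t} - (1 - \<alpha>)"
        using near t by (intro Kx.widened_interval_mass[OF lip ab lohi]) auto
      then show "2 * \<mu>_low * t - \<mu>_up * endpoint_error g x
          \<le> measure (K x) {lower_endpoint \<alpha> g x - t..upper_endpoint \<alpha> g x + t} - (1 - \<alpha>)"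
        using err by (simp add: a_def b_def)
      have "measure (K x) {a + t..b - t} - (1 - \<alpha>)
          \<le> - (2 * \<mu>_low * t - \<mu>_up * (\<bar>a - q_lo x\<bar> + \<bar>b - q_hi x\<bar>))"
        using near t \<mu>_pos fits by (intro Kx.narrowed_interval_mass[OF lip _ lohi]) auto
      then show "measure (K x) {lower_endpoint \<alpha> g x + t..upper_endpoint \<alpha> g x - t} - (1 - \<alpha>)
          \<le> - (2 * \<mu>_low * t - \<mu>_up * endpoint_error g x)"
        using err by (simp add: a_def b_def)
    qed
  qed
qed

text \<open>Its sum over the calibration sample is nonnegative exactly when the scores up to \<open>s\<close> carry at least
  the fraction \<open>1 - \<alpha>\<close> of the total calibration weight. Centring inside the sum treats the numerator and
  the random normalisation of the weighted distribution function by a single concentration bound.\<close>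
definition centred_weight :: "(real \<Rightarrow> 'x \<Rightarrow> real) \<Rightarrow> real \<Rightarrow> 'x \<times> real \<Rightarrow> real" where
  "centred_weight g s z = w (fst z) * (of_bool (score \<alpha> g (fst z) (snd z) \<le> s) - (1 - \<alpha>))"

definition endpoints_measurable :: "(real \<Rightarrow> 'x \<Rightarrow> real) \<Rightarrow> bool" where
  "endpoints_measurable g \<longleftrightarrow> g (\<alpha> / 2) \<in> borel_measurable PX \<and> g (1 - \<alpha> / 2) \<in> borel_measurable PX"

lemma endpoint_measurable:
  assumes "endpoints_measurable g"
  shows "lower_endpoint \<alpha> g \<in> borel_measurable PX" "upper_endpoint \<alpha> g \<in> borel_measurable PX"
    "endpoint_error g \<in> borel_measurable PX"
proof -
  have [measurable]: "g (\<alpha> / 2) \<in> borel_measurable PX" "g (1 - \<alpha> / 2) \<in> borel_measurable PX"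
    using assms by (auto simp: endpoints_measurable_def)
  show "lower_endpoint \<alpha> g \<in> borel_measurable PX" "upper_endpoint \<alpha> g \<in> borel_measurable PX"
    "endpoint_error g \<in> borel_measurable PX"
    unfolding lower_endpoint_def[abs_def] upper_endpoint_def[abs_def] endpoint_error_def[abs_def]
    by measurable
qed

lemma centred_weight_measurable:
  assumes "endpoints_measurable g"
  shows "centred_weight g s \<in> borel_measurable (PX \<Otimes>\<^sub>M borel)"
proof -
  note [measurable] = endpoint_measurable[OF assms]
  show ?thesis unfolding centred_weight_def[abs_def] score_def by measurable
qed

lemma centred_weight_bound:
  assumes "x \<in> space PX"
  shows "\<bar>centred_weight g s (x, y)\<bar> \<le> w x" "\<bar>centred_weight g s (x, y)\<bar> \<le> w_max"
proof -
  have "\<bar>of_bool (score \<alpha> g x y \<le> s) - (1 - \<alpha>)\<bar> \<le> 1" using \<alpha> by (auto simp: of_bool_def)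
  then show "\<bar>centred_weight g s (x, y)\<bar> \<le> w x"
    using w_bounds[OF assms] mult_left_mono[of _ 1 "w x"] by (simp add: centred_weight_def abs_mult)
  then show "\<bar>centred_weight g s (x, y)\<bar> \<le> w_max" using w_bounds[OF assms] by simp
qed

lemma expectation_centred_weight:
  assumes g: "endpoints_measurable g"
  shows "(\<integral>z. centred_weight g s z \<partial>joint_law PX K)
    = (\<integral>x. w x * (measure (K x) {lower_endpoint \<alpha> g x - s..upper_endpoint \<alpha> g x + s} - (1 - \<alpha>)) \<partial>PX)"
proof -
  have "(\<integral>z. centred_weight g s z \<partial>joint_law PX K) = (\<integral>x. \<integral>y. centred_weight g s (x, y) \<partial>K x \<partial>PX)"
    by (rule integral_joint_law[OF PX K centred_weight_measurable[OF g], where B=w_max])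
       (auto simp: space_pair_measure centred_weight_bound)
  also have "\<dots> = (\<integral>x. w x * (measure (K x) {lower_endpoint \<alpha> g x - s..upper_endpoint \<alpha> g x + s} - (1 - \<alpha>)) \<partial>PX)"
  proof (rule Bochner_Integration.integral_cong[OF refl])
    fix x assume x: "x \<in> space PX"
    interpret Kx: real_distribution "K x" by (rule real_distribution_kernel[OF K x])
    let ?I = "{lower_endpoint \<alpha> g x - s..upper_endpoint \<alpha> g x + s}"
    have int: "integrable (K x) (indicator ?I :: real \<Rightarrow> real)" 
      by (rule Kx.integrable_const_bound[where B=1]) (auto simp: indicator_def)
    have "(\<integral>y. centred_weight g s (x, y) \<partial>K x) = (\<integral>y. w x * (indicator ?I y - (1 - \<alpha>)) \<partial>K x)"
      by (intro Bochner_Integration.integral_cong)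
         (auto simp: centred_weight_def score_le_iff indicator_def)
    also have "\<dots> = w x * (measure (K x) ?I - (1 - \<alpha>))"
      using int Kx.prob_space by simp
    finally show "(\<integral>y. centred_weight g s (x, y) \<partial>K x) = w x * (measure (K x) ?I - (1 - \<alpha>))" .
  qed
  finally show ?thesis .
qed

text \<open>Since \<open>\<bar>of_bool b - (1 - \<alpha>)\<bar> \<le> 1\<close>, the second moment is at most that of \<open>w\<close>, which is
  \<open>1 + chi_square PX w\<close>.\<close>
lemma second_moment_centred_weight:
  assumes g: "endpoints_measurable g"
  shows "(\<integral>z. (centred_weight g s z)\<^sup>2 \<partial>joint_law PX K) \<le> 1 + chi_square PX w"
proof -
  note [measurable] = centred_weight_measurable[OF g] and [measurable_cong] = sets_joint_law[OF PX K]
  have space: "space (joint_law PX K) = space (PX \<Otimes>\<^sub>M borel)"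
    using sets_joint_law[OF PX K] by (rule sets_eq_imp_space_eq)
  have sq: "(centred_weight g s (x, y))\<^sup>2 \<le> (w x)\<^sup>2" if "x \<in> space PX" for x y
    using centred_weight_bound(1)[OF that] w_bounds[OF that] by (simp add: abs_le_square_iff[symmetric])
  have sq_max: "(centred_weight g s (x, y))\<^sup>2 \<le> w_max\<^sup>2" if "x \<in> space PX" for x y
    using centred_weight_bound(2)[OF that] w_max_ge_1 by (simp add: abs_le_square_iff[symmetric])
  have wsq: "(w x)\<^sup>2 \<le> w_max\<^sup>2" if "x \<in> space PX" for x
    using w_bounds[OF that] by (intro power_mono) auto
  have "(\<integral>z. (centred_weight g s z)\<^sup>2 \<partial>joint_law PX K) \<le> (\<integral>z. (w (fst z))\<^sup>2 \<partial>joint_law PX K)"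
  proof (rule integral_mono)
    show "integrable (joint_law PX K) (\<lambda>z. (centred_weight g s z)\<^sup>2)"
      by (rule joint.integrable_const_bound[where B="w_max\<^sup>2"])
         (use sq_max in \<open>auto simp: space space_pair_measure intro!: AE_I2\<close>)
    show "integrable (joint_law PX K) (\<lambda>z. (w (fst z))\<^sup>2)"
      by (rule joint.integrable_const_bound[where B="w_max\<^sup>2"])
         (use wsq in \<open>auto simp: space space_pair_measure intro!: AE_I2\<close>)
  qed (use sq in \<open>auto simp: space space_pair_measure\<close>)
  also have "\<dots> = (\<integral>x. \<integral>y. (w x)\<^sup>2 \<partial>K x \<partial>PX)"
    using wsq by (subst integral_joint_law[OF PX K, where B="w_max\<^sup>2"]) (auto simp: space_pair_measure)
  also have "\<dots> = (\<integral>x. (w x)\<^sup>2 \<partial>PX)"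
  proof (rule Bochner_Integration.integral_cong[OF refl])
    fix x assume x: "x \<in> space PX"
    interpret Kx: real_distribution "K x" by (rule real_distribution_kernel[OF K x])
    show "(\<integral>y. (w x)\<^sup>2 \<partial>K x) = (w x)\<^sup>2" using Kx.prob_space by simp
  qed
  finally show ?thesis by (simp add: chi_square_eq)
qed

end

section \<open>Calibration and the length of the prediction set\<close>

text \<open>If \<open>max a b + q < min a b - q\<close>, the prediction set is empty, and truncating its length at \<open>0\<close> only
  moves it towards the nonnegative oracle length \<open>hi - lo\<close>.\<close>
lemma length_error_le:
  fixes lo hi a b q t :: real
  assumes "lo \<le> hi" "- t \<le> q" "q \<le> t"
  shows "\<bar>max 0 (max a b - min a b + 2 * q) - max 0 (hi - lo)\<bar> \<le> \<bar>a - lo\<bar> + \<bar>b - hi\<bar> + 2 * t"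
  using assms by (simp add: max_def min_def abs_if split: if_splits)

context covariate_shift_regression
begin

text \<open>The good event for the calibration sample. The first inequality carries the margin
  \<open>(1 - \<alpha>) * w_max\<close> that pays for the mass which any test point places at \<open>\<infinity>\<close>; it forces the threshold
  below \<open>t\<close>, while the second one forces it above \<open>- t\<close>.\<close>
definition calibrated :: "(real \<Rightarrow> 'x \<Rightarrow> real) \<Rightarrow> nat \<Rightarrow> real \<Rightarrow> (nat \<Rightarrow> 'x \<times> real) \<Rightarrow> bool" where
  "calibrated g m t C \<longleftrightarrow>
     (1 - \<alpha>) * w_max \<le> (\<Sum>j<m. centred_weight g t (C j)) \<and> (\<Sum>j<m. centred_weight g (- t) (C j)) < 0"

lemma expectation_centred_weight_bounds:
  assumes g: "endpoints_measurable g" and t: "admissible_widening t"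
    and D: "0 \<le> D" "(\<integral>\<^sup>+x. ennreal (endpoint_error g x) \<partial>QX) \<le> ennreal D"
  shows "2 * \<mu>_low * t - \<mu>_up * D \<le> (\<integral>z. centred_weight g t z \<partial>joint_law PX K)"
    and "(\<integral>z. centred_weight g (- t) z \<partial>joint_law PX K) \<le> - (2 * \<mu>_low * t - \<mu>_up * D)"
proof -
  note [measurable] = endpoint_measurable[OF g] and [measurable] = measurable_prob_algebraD[OF K]
  define u where "u s x = measure (K x) {lower_endpoint \<alpha> g x - s..upper_endpoint \<alpha> g x + s} - (1 - \<alpha>)" for s x
  have u_measurable[measurable]: "u s \<in> borel_measurable PX" for s
  proof -
    have "{z \<in> space (PX \<Otimes>\<^sub>M borel). lower_endpoint \<alpha> g (fst z) - s \<le> snd z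
        \<and> snd z \<le> upper_endpoint \<alpha> g (fst z) + s} \<in> sets (PX \<Otimes>\<^sub>M borel)"
      by measurable
    also have "{z \<in> space (PX \<Otimes>\<^sub>M borel). lower_endpoint \<alpha> g (fst z) - s \<le> snd z
        \<and> snd z \<le> upper_endpoint \<alpha> g (fst z) + s}
      = Sigma (space PX) (\<lambda>x. {lower_endpoint \<alpha> g x - s..upper_endpoint \<alpha> g x + s})"
      by (auto simp: space_pair_measure)
    finally have [measurable]: "(\<lambda>x. measure (K x) {lower_endpoint \<alpha> g x - s..upper_endpoint \<alpha> g x + s})
        \<in> borel_measurable PX"
      using K by (rule measure_measurable_prob_algebra2)
    show ?thesis unfolding u_def by measurable
  qed
  have u_bound: "\<bar>u s x\<bar> \<le> 1" if "x \<in> space PX" for s x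
  proof -
    interpret Kx: real_distribution "K x" by (rule real_distribution_kernel[OF K that])
    show ?thesis using Kx.prob_le_1[of "{lower_endpoint \<alpha> g x - s..upper_endpoint \<alpha> g x + s}"] \<alpha>
      measure_nonneg[of "K x" "{lower_endpoint \<alpha> g x - s..upper_endpoint \<alpha> g x + s}"]
      unfolding u_def by linarith
  qed
  have "AE x in PX. 2 * \<mu>_low * t - \<mu>_up * endpoint_error g x \<le> u t x \<and>
      2 * \<mu>_low * t - \<mu>_up * endpoint_error g x \<le> - u (- t) x"
    using AE_regular
  proof eventually_elim
    case (elim x)
    from elim[THEN conjunct2, rule_format, OF t, of g] show ?case by (simp add: u_def)
  qed
  then have *: "AE x in PX. 2 * \<mu>_low * t - \<mu>_up * endpoint_error g x \<le> u t x"
    "AE x in PX. 2 * \<mu>_low * t - \<mu>_up * endpoint_error g x \<le> - u (- t) x"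
    by auto
  have err: "0 \<le> endpoint_error g x" for x by (simp add: endpoint_error_def)
  have "2 * \<mu>_low * t - \<mu>_up * D \<le> (\<integral>x. w x * u t x \<partial>PX)"
    by (rule PX.weighted_integral_lower_bound[where C=w_max and B=1 and d="endpoint_error g"])
       (use w_bounds integral_w u_bound err D \<mu>_pos * in \<open>auto simp: QX_eq\<close>)
  then show "2 * \<mu>_low * t - \<mu>_up * D \<le> (\<integral>z. centred_weight g t z \<partial>joint_law PX K)"
    by (simp add: expectation_centred_weight[OF g] u_def)
  have "2 * \<mu>_low * t - \<mu>_up * D \<le> (\<integral>x. w x * - u (- t) x \<partial>PX)"
    by (rule PX.weighted_integral_lower_bound[where C=w_max and B=1 and d="endpoint_error g"])
       (use w_bounds integral_w u_bound err D \<mu>_pos * in \<open>auto simp: QX_eq\<close>)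
  then have "(\<integral>x. w x * u (- t) x \<partial>PX) \<le> - (2 * \<mu>_low * t - \<mu>_up * D)"
    by simp
  then show "(\<integral>z. centred_weight g (- t) z \<partial>joint_law PX K) \<le> - (2 * \<mu>_low * t - \<mu>_up * D)"
    by (simp only: expectation_centred_weight[OF g] u_def)
qed

text \<open>Two applications of Bernstein's inequality, to \<open>- centred_weight g t\<close> and to
  \<open>centred_weight g (- t)\<close>. The hypothesis \<open>margin\<close> says that the drift of the sums beats the
  fluctuations together with the margin \<open>(1 - \<alpha>) * w_max\<close>.\<close>
lemma calibration_probability:
  assumes g: "endpoints_measurable g" and t: "admissible_widening t"
    and D: "0 \<le> D" "(\<integral>\<^sup>+x. ennreal (endpoint_error g x) \<partial>QX) \<le> ennreal D"
    and m: "1 \<le> m" and L: "0 < L"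
    and margin: "2 * sqrt (m * (1 + chi_square PX w) * L) + w_max * L + (1 - \<alpha>) * w_max
       \<le> m * (2 * \<mu>_low * t - \<mu>_up * D)"
  shows "1 - 2 * exp (- L) \<le> measure (sample_law PX K m) {C \<in> space (sample_law PX K m). calibrated g m t C}"
proof -
  let ?S = "sample_law PX K m"
  let ?E = "\<lambda>s. \<integral>z. centred_weight g s z \<partial>joint_law PX K"
  define V where "V = 1 + chi_square PX w"
  define r where "r = 2 * sqrt (m * V * L) + w_max * L"
  interpret S: prob_space ?S by (rule prob_space_sample_law[OF PX K])
  note [measurable] = centred_weight_measurable[OF g] and [measurable_cong] = sets_joint_law[OF PX K]
  have space: "space (joint_law PX K) = space (PX \<Otimes>\<^sub>M borel)"
    using sets_joint_law[OF PX K] by (rule sets_eq_imp_space_eq)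
  have bound: "\<bar>centred_weight g s z\<bar> \<le> w_max" if "z \<in> space (joint_law PX K)" for s z
    using that centred_weight_bound(2) by (cases z) (auto simp: space space_pair_measure)
  have V: "0 < V" "0 < w_max" using chi_square_nonneg w_max_ge_1 by (auto simp: V_def)
  have second: "(\<integral>z. (centred_weight g s z)\<^sup>2 \<partial>joint_law PX K) \<le> V" for s
    unfolding V_def by (rule second_moment_centred_weight[OF g])
  have mE: "m * (2 * \<mu>_low * t - \<mu>_up * D) \<le> m * ?E t" "m * ?E (- t) \<le> - (m * (2 * \<mu>_low * t - \<mu>_up * D))"
    using mult_left_mono[OF expectation_centred_weight_bounds(1)[OF g t D], of m]
      mult_left_mono[OF expectation_centred_weight_bounds(2)[OF g t D], of m]
    by (simp_all only: of_nat_0_le_iff mult_minus_right)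
  define A1 where "A1 = {C \<in> space ?S. m * (\<integral>z. - centred_weight g t z \<partial>joint_law PX K) + r
      \<le> (\<Sum>j<m. - centred_weight g t (C j))}"
  define A2 where "A2 = {C \<in> space ?S. m * ?E (- t) + r \<le> (\<Sum>j<m. centred_weight g (- t) (C j))}"
  have A1: "measure ?S A1 \<le> exp (- L)"
    unfolding A1_def r_def sample_law_def add.assoc[symmetric]
    using bound second V L m by (intro joint.Bernstein_upper_tail) auto
  have A2: "measure ?S A2 \<le> exp (- L)"
    unfolding A2_def r_def sample_law_def add.assoc[symmetric]
    using bound second V L m by (intro joint.Bernstein_upper_tail) auto
  have comp: "(\<lambda>C. centred_weight g s (C j)) \<in> borel_measurable ?S" if "j < m" for s j
    using sample_component[OF PX K that] centred_weight_measurable[OF g] by (rule measurable_compose)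
  have sums[measurable]: "(\<lambda>C. \<Sum>j<m. centred_weight g s (C j)) \<in> borel_measurable ?S" for s
    by (intro borel_measurable_sum comp) simp
  have neg_sums[measurable]: "(\<lambda>C. \<Sum>j<m. - centred_weight g s (C j)) \<in> borel_measurable ?S" for s
    by (intro borel_measurable_sum borel_measurable_uminus comp) simp
  have sets: "A1 \<in> S.events" "A2 \<in> S.events" unfolding A1_def A2_def by measurable
  have good: "{C \<in> space ?S. calibrated g m t C} \<in> S.events" unfolding calibrated_def by measurable
  have "space ?S - (A1 \<union> A2) \<subseteq> {C \<in> space ?S. calibrated g m t C}"
  proof safe
    fix C assume C: "C \<in> space ?S" "C \<notin> A1" "C \<notin> A2"
    have "- (\<Sum>j<m. centred_weight g t (C j)) < - (m * ?E t) + r"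
      using C by (simp add: A1_def sum_negf)
    moreover have "(\<Sum>j<m. centred_weight g (- t) (C j)) < m * ?E (- t) + r"
      using C by (simp add: A2_def)
    moreover have "r + (1 - \<alpha>) * w_max \<le> m * (2 * \<mu>_low * t - \<mu>_up * D)"
      using margin by (simp add: r_def V_def)
    moreover have "0 \<le> (1 - \<alpha>) * w_max" using \<alpha> V by simp
    ultimately show "calibrated g m t C" using mE unfolding calibrated_def by linarith
  qed
  then have "measure ?S (space ?S - (A1 \<union> A2)) \<le> measure ?S {C \<in> space ?S. calibrated g m t C}"
    using good by (rule S.finite_measure_mono)
  moreover have "measure ?S (space ?S - (A1 \<union> A2)) = 1 - measure ?S (A1 \<union> A2)"
    using sets by (intro S.prob_compl) auto
  moreover have "measure ?S (A1 \<union> A2) \<le> measure ?S A1 + measure ?S A2"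
    using sets by (rule measure_Un_le)
  ultimately show ?thesis using A1 A2 by linarith
qed

lemma calibrated_threshold:
  assumes cal: "calibrated g m t C" and C: "\<And>i. i < m \<Longrightarrow> fst (C i) \<in> space PX" and x: "x \<in> space PX"
  shows "ereal (- t) \<le> weighted_threshold \<alpha> w g m C x" "weighted_threshold \<alpha> w g m C x \<le> ereal t"
proof -
  have split: "(\<Sum>j<m. centred_weight g s (C j))
      = (\<Sum>j<m. w (fst (C j)) * of_bool (score \<alpha> g (fst (C j)) (snd (C j)) \<le> s))
        - (1 - \<alpha>) * (\<Sum>i<m. w (fst (C i)))" for s
    unfolding centred_weight_def
    by (simp only: right_diff_distrib sum_subtractf sum_distrib_left mult.commute[of "1 - \<alpha>"])
  show "weighted_threshold \<alpha> w g m C x \<le> ereal t"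
    using cal C x w_bounds \<alpha> w_max_ge_1
    by (intro weighted_threshold_le[where C=w_max])
       (auto simp: calibrated_def split distrib_left)
  show "ereal (- t) \<le> weighted_threshold \<alpha> w g m C x"
    using cal C x w_bounds \<alpha>
    by (intro weighted_threshold_ge) (auto simp: calibrated_def split)
qed

lemma root_exponent_pos: "0 < root_exponent w_max p"
  using w_max_ge_1 by (simp add: root_exponent_def)

lemma endpoint_error_Lp_norm:
  assumes g: "endpoints_measurable g" and p: "1 \<le> p" and e: "0 < e"
    and lo: "Lp_norm p PX (\<lambda>x. ereal (g (\<alpha> / 2) x - q_lo x)) \<le> ennreal e"
    and hi: "Lp_norm p PX (\<lambda>x. ereal (g (1 - \<alpha> / 2) x - q_hi x)) \<le> ennreal e"
  shows "Lp_norm p QX (\<lambda>x. ereal (endpoint_error g x)) \<le> ennreal (2 * root_exponent w_max p * e)"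
proof -
  let ?R = "root_exponent w_max p"
  have [measurable]: "g (\<alpha> / 2) \<in> borel_measurable PX" "g (1 - \<alpha> / 2) \<in> borel_measurable PX"
    using g by (auto simp: endpoints_measurable_def)
  note [measurable] = endpoint_measurable[OF g]
  have "Lp_norm p QX (\<lambda>x. ereal (g (\<alpha> / 2) x - q_lo x)) \<le> ennreal (?R * e)"
    unfolding QX_eq using w_bounds w_max_ge_1 p e lo by (intro Lp_norm_density_le) auto
  moreover have "Lp_norm p QX (\<lambda>x. ereal (g (1 - \<alpha> / 2) x - q_hi x)) \<le> ennreal (?R * e)"
    unfolding QX_eq using w_bounds w_max_ge_1 p e hi by (intro Lp_norm_density_le) auto
  ultimately have "Lp_norm p QX (\<lambda>x. ereal (endpoint_error g x)) \<le> ennreal (?R * e + ?R * e)"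
    using root_exponent_pos[of p] e
    by (intro Lp_norm_triangle[OF p, where g="\<lambda>x. g (\<alpha> / 2) x - q_lo x"
          and h="\<lambda>x. g (1 - \<alpha> / 2) x - q_hi x"]) (auto simp: endpoint_error_def)
  then show ?thesis by (simp add: algebra_simps)
qed

text \<open>The norm bounds above require positive radii; a zero error is reached by letting the slack \<open>d\<close>
  tend to \<open>0\<close>.\<close>
lemma endpoint_error_mean:
  assumes g: "endpoints_measurable g" and p: "1 \<le> p" and e: "0 \<le> e"
    and lo: "Lp_norm p PX (\<lambda>x. ereal (g (\<alpha> / 2) x - q_lo x)) \<le> ennreal e"
    and hi: "Lp_norm p PX (\<lambda>x. ereal (g (1 - \<alpha> / 2) x - q_hi x)) \<le> ennreal e"
  shows "(\<integral>\<^sup>+x. ennreal (endpoint_error g x) \<partial>QX) \<le> ennreal (2 * root_exponent w_max p * e)"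
proof (rule ennreal_le_epsilon)
  let ?R = "root_exponent w_max p"
  fix d :: real assume d: "0 < d"
  define e' where "e' = e + d / (2 * ?R)"
  have "0 < d / (2 * ?R)" using root_exponent_pos[of p] d by simp
  then have e': "e \<le> e'" "0 < e'" unfolding e'_def using e by linarith+
  have e'_scaled: "2 * ?R * e' = 2 * ?R * e + d"
    using root_exponent_pos[of p] by (simp add: e'_def field_simps)
  have "Lp_norm p QX (\<lambda>x. ereal (endpoint_error g x)) \<le> ennreal (2 * ?R * e')"
    using e'(1) lo hi by (intro endpoint_error_Lp_norm[OF g p e'(2)]) (auto intro: order_trans ennreal_leI)
  then have "(\<integral>\<^sup>+x. ennreal \<bar>endpoint_error g x\<bar> \<partial>QX) \<le> ennreal (2 * ?R * e')"
    using endpoint_measurable(3)[OF g] root_exponent_pos[of p] e'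
    by (intro QX.nn_integral_le_Lp_norm[OF p]) auto
  also have "(\<integral>\<^sup>+x. ennreal \<bar>endpoint_error g x\<bar> \<partial>QX) = (\<integral>\<^sup>+x. ennreal (endpoint_error g x) \<partial>QX)"
    by (simp add: endpoint_error_def)
  also have "ennreal (2 * ?R * e') = ennreal (2 * ?R * e) + ennreal d"
    using e'_scaled d e root_exponent_pos[of p] by simp
  finally show "(\<integral>\<^sup>+x. ennreal (endpoint_error g x) \<partial>QX) \<le> ennreal (2 * ?R * e) + ennreal d" .
qed

text \<open>On the good event the length error is at most the endpoint error plus \<open>2 * t\<close> at almost every
  covariate, and the triangle inequality finishes. As before, the slack \<open>d\<close> allows \<open>e = 0\<close>.\<close>
lemma length_error_Lp_norm:
  assumes g: "endpoints_measurable g" and p: "1 \<le> p" and e: "0 \<le> e"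
    and lo: "Lp_norm p PX (\<lambda>x. ereal (g (\<alpha> / 2) x - q_lo x)) \<le> ennreal e"
    and hi: "Lp_norm p PX (\<lambda>x. ereal (g (1 - \<alpha> / 2) x - q_hi x)) \<le> ennreal e"
    and cal: "calibrated g m t C" and C: "\<And>i. i < m \<Longrightarrow> fst (C i) \<in> space PX" and t: "0 < t"
  shows "Lp_norm p QX (\<lambda>x. len (weighted_cqr_set \<alpha> w g m C x) - len (oracle_interval K \<alpha> x))
     \<le> ennreal (2 * root_exponent w_max p * e + 2 * t)"
proof (rule ennreal_le_epsilon)
  let ?R = "root_exponent w_max p"
  fix d :: real assume d: "0 < d"
  define e' where "e' = e + d / (2 * ?R)"
  have "0 < d / (2 * ?R)" using root_exponent_pos[of p] d by simp
  then have e': "e \<le> e'" "0 < e'" unfolding e'_def using e by linarith+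
  have e'_scaled: "2 * ?R * e' = 2 * ?R * e + d"
    using root_exponent_pos[of p] by (simp add: e'_def field_simps)
  define thr where "thr x = real_of_ereal (weighted_threshold \<alpha> w g m C x)" for x
  define k where "k x = max 0 (upper_endpoint \<alpha> g x - lower_endpoint \<alpha> g x + 2 * thr x)
      - max 0 (q_hi x - q_lo x)" for x
  note bounds = calibrated_threshold[OF cal C]
  have thr: "weighted_threshold \<alpha> w g m C x = ereal (thr x)" "- t \<le> thr x" "thr x \<le> t"
    if "x \<in> space PX" for x
    using bounds[OF _ that] unfolding thr_def
    by (cases "weighted_threshold \<alpha> w g m C x"; auto)+
  note [measurable] = endpoint_measurable[OF g]
  have [measurable]: "weighted_threshold \<alpha> w g m C \<in> borel_measurable PX"
    using w_bounds C by (intro measurable_weighted_threshold) auto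
  have [measurable]: "k \<in> borel_measurable PX" unfolding k_def thr_def by measurable
  have len: "len (weighted_cqr_set \<alpha> w g m C x) - len (oracle_interval K \<alpha> x) = ereal (k x)"
    if "x \<in> space PX" for x
  proof -
    have "upper_endpoint \<alpha> g x + thr x - (lower_endpoint \<alpha> g x - thr x)
        = upper_endpoint \<alpha> g x - lower_endpoint \<alpha> g x + 2 * thr x" by simp
    then show ?thesis
      unfolding weighted_cqr_set_eq[OF thr(1)[OF that]] oracle_interval_def len_interval k_def
      by (simp only: ereal_minus)
  qed
  have "AE x in PX. \<bar>k x\<bar> \<le> \<bar>endpoint_error g x\<bar> + \<bar>2 * t\<bar>"
    using AE_regular AE_space
  proof eventually_elim
    case (elim x)
    then show ?case
      using length_error_le[OF elim(1)[THEN conjunct1] thr(2,3)[OF elim(2)], of "g (\<alpha> / 2) x" "g (1 - \<alpha> / 2) x"] t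
      by (simp add: k_def lower_endpoint_def upper_endpoint_def endpoint_error_def)
  qed
  then have AE: "AE x in QX. \<bar>k x\<bar> \<le> \<bar>endpoint_error g x\<bar> + \<bar>2 * t\<bar>"
    unfolding QX_eq by (subst AE_density) (auto elim: eventually_mono)
  have err: "Lp_norm p QX (\<lambda>x. ereal (endpoint_error g x)) \<le> ennreal (2 * ?R * e')"
    using e'(1) lo hi by (intro endpoint_error_Lp_norm[OF g p e'(2)]) (auto intro: order_trans ennreal_leI)
  have const: "Lp_norm p QX (\<lambda>x. ereal (2 * t)) \<le> ennreal (2 * t)"
    using t by (intro QX.Lp_norm_const[OF p]) simp
  have "Lp_norm p QX (\<lambda>x. ereal (k x)) \<le> ennreal (2 * ?R * e' + 2 * t)"
    by (rule Lp_norm_triangle[OF p _ _ _ _ _ err const AE])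
       (use root_exponent_pos[of p] e' t in auto)
  also have "\<dots> = ennreal (2 * ?R * e + 2 * t) + ennreal d"
    using e'_scaled d e t root_exponent_pos[of p] by (simp add: ennreal_plus[symmetric] del: ennreal_plus)
  also have "Lp_norm p QX (\<lambda>x. ereal (k x))
      = Lp_norm p QX (\<lambda>x. len (weighted_cqr_set \<alpha> w g m C x) - len (oracle_interval K \<alpha> x))"
    by (rule Lp_norm_cong) (simp add: len)
  finally show "Lp_norm p QX (\<lambda>x. len (weighted_cqr_set \<alpha> w g m C x) - len (oracle_interval K \<alpha> x))
     \<le> ennreal (2 * ?R * e + 2 * t) + ennreal d" .
qed

end

section \<open>Length error of weighted conformalised quantile regression\<close>

theorem proposition4:
  fixes PX QX :: "'x measure"
    and K :: "'x \<Rightarrow> real measure"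
    and w :: "'x \<Rightarrow> real"
    and f :: "'x training"
    and \<epsilon> :: "nat \<Rightarrow> real \<Rightarrow> real"
    and p :: ereal
    and \<alpha> \<delta> \<mu>_low \<mu>_up r0 w_max :: real
    and n m :: nat
    and \<Omega> :: "'w measure"
    and Dtr Dcal :: "'w \<Rightarrow> nat \<Rightarrow> 'x \<times> real"
  assumes "prob_space PX"
    and "K \<in> PX \<rightarrow>\<^sub>M prob_algebra borel"
    and "0 < \<alpha>" "\<alpha> < 1"
    and "1 \<le> p"
    and "mass_regularity PX K \<alpha> \<mu>_low \<mu>_up r0"
    and "covariate_shift PX QX w w_max"
    and "measurable_training PX K \<alpha> f"
    and "endpoint_accuracy p PX K \<alpha> f \<epsilon>"
    and "prob_space \<Omega>"
    and "Dtr \<in> \<Omega> \<rightarrow>\<^sub>M sample_law PX K n"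
    and "distr \<Omega> (sample_law PX K n) Dtr = sample_law PX K n"
    and "Dcal \<in> \<Omega> \<rightarrow>\<^sub>M sample_law PX K m"
    and "distr \<Omega> (sample_law PX K m) Dcal = sample_law PX K m"
    and "prob_space.indep_var \<Omega> (sample_law PX K n) Dtr (sample_law PX K m) Dcal"
    and "0 < \<delta>" "\<delta> < 1"
    and "1 \<le> n" "1 \<le> m"
    and "2 * \<mu>_up * root_exponent w_max p * \<epsilon> n (\<delta>/4) + (2 - \<alpha>) * eta_w PX w w_max m \<delta>
           < 2 * \<mu>_low * r_minus r0 \<alpha> \<mu>_up"
    and "2 * \<mu>_up * root_exponent w_max p * \<epsilon> n (\<delta>/4) + (2 - \<alpha>) * eta_w PX w w_max m \<delta>
             + (1 - \<alpha>) * w_max / real m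
           \<le> 2 * \<mu>_low * r_plus r0"
  shows "\<exists>A. A \<in> sets (vimage_algebra (space \<Omega>) (\<lambda>\<omega>. (Dtr \<omega>, Dcal \<omega>))
                      (sample_law PX K n \<Otimes>\<^sub>M sample_law PX K m)) \<and>
             measure \<Omega> A \<ge> 1 - \<delta> \<and>
             (\<forall>\<omega>\<in>A.
                (AE x in QX. \<bar>weighted_threshold \<alpha> w (f n (Dtr \<omega>)) m (Dcal \<omega>) x\<bar> \<noteq> \<infinity>) \<and>
                Lp_norm p QX (\<lambda>x. len (weighted_cqr_set \<alpha> w (f n (Dtr \<omega>)) m (Dcal \<omega>) x)
                                  - len (oracle_interval K \<alpha> x))
                  \<le> ennreal (2 * (1 + \<mu>_up / \<mu>_low) * root_exponent w_max p * \<epsilon> n (\<delta>/4))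
                    + (ennreal ((2 - \<alpha>) * eta_w PX w w_max m \<delta>)
                       + ennreal (1 - \<alpha>) * Lp_norm p QX (\<lambda>x. ereal (w x)) / of_nat m)
                      / ennreal \<mu>_low)"
proof -
  interpret covariate_shift_regression PX QX K w \<alpha> \<mu>_low \<mu>_up r0 w_max
    using assms(1-4,6,7) by (rule covariate_shift_regression.intro)
  interpret \<Omega>: prob_space \<Omega> by fact
  define N where "N = sample_law PX K n"
  define M where "M = sample_law PX K m"
  interpret N: prob_space N unfolding N_def by (rule prob_space_sample_law[OF PX K])
  interpret M: prob_space M unfolding M_def by (rule prob_space_sample_law[OF PX K])
  define R where "R = root_exponent w_max p"
  define e where "e = \<epsilon> n (\<delta>/4)"
  define \<eta> where "\<eta> = eta_w PX w w_max m \<delta>"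
  define L where "L = ln (4 / \<delta>)"
  define t where "t = (2 * \<mu>_up * R * e + (2 - \<alpha>) * \<eta>) / (2 * \<mu>_low)"
  \<comment> \<open>\<open>t\<close> is the widening at which the coverage gain \<open>2 * \<mu>_low * t\<close> exactly balances the loss from the
    endpoint errors plus the fluctuation \<open>(2 - \<alpha>) * \<eta>\<close>.\<close>
  have p: "1 \<le> p" and m: "1 \<le> m" and \<delta>: "0 < \<delta>" "\<delta> < 1" by fact+
  have acc: "0 \<le> e"
    "\<And>\<tau>. \<tau> \<in> {\<alpha>/2, 1 - \<alpha>/2} \<Longrightarrow>
      1 - \<delta>/4 \<le> measure N {D \<in> space N. Lp_norm p PX (\<lambda>x. ereal (f n D \<tau> x - cond_quantile K \<tau> x)) \<le> ennreal e}"
    using assms(9,18) \<delta> unfolding endpoint_accuracy_def N_def e_def by auto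
  have R: "0 < R" unfolding R_def by (rule root_exponent_pos)
  have "1 \<le> ln (4::real)" using exp_le by (subst ln_ge_iff) auto
  also have "ln 4 \<le> L" using \<delta> by (simp add: L_def le_divide_eq)
  finally have L: "1 \<le> L" .
  have exp_L: "exp (- L) = \<delta> / 4" using \<delta> by (simp add: L_def exp_minus)
  have m_pos: "0 < real m" using m by simp
  have m_\<eta>: "m * \<eta> = 9 * sqrt (m * (1 + chi_square PX w) * L) + 4 / 3 * w_max * L"
  proof -
    have "m * sqrt ((1 + chi_square PX w) * L / m) = sqrt ((real m)\<^sup>2 * ((1 + chi_square PX w) * L / m))"
      by (subst real_sqrt_mult) simp
    also have "(real m)\<^sup>2 * ((1 + chi_square PX w) * L / m) = m * (1 + chi_square PX w) * L"
      using m_pos by (simp add: power2_eq_square)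
    finally show ?thesis using m_pos by (simp add: \<eta>_def eta_w_def L_def distrib_left)
  qed
  have \<eta>: "0 < \<eta>"
  proof -
    have "0 < 4 / 3 * w_max * L" using w_max_ge_1 L by simp
    moreover have "0 \<le> sqrt (m * (1 + chi_square PX w) * L)" using chi_square_nonneg L by simp
    ultimately have "0 < m * \<eta>" unfolding m_\<eta> by linarith
    then show ?thesis using m_pos by (simp add: zero_less_mult_iff)
  qed
  have low_t: "2 * \<mu>_low * t = 2 * \<mu>_up * R * e + (2 - \<alpha>) * \<eta>"
    using \<mu>_pos by (simp add: t_def)
  have "0 \<le> 2 * \<mu>_up * R * e" using \<mu>_pos R acc(1) by simp
  moreover have "0 < (2 - \<alpha>) * \<eta>" using \<alpha> \<eta> by simp
  ultimately have "0 < 2 * \<mu>_up * R * e + (2 - \<alpha>) * \<eta>" by (rule add_nonneg_pos)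
  then have t_pos: "0 < t" unfolding t_def using \<mu>_pos by (intro divide_pos_pos) auto
  have "2 * \<mu>_low * t < 2 * \<mu>_low * r_minus r0 \<alpha> \<mu>_up"
    using assms(20) unfolding low_t R_def e_def \<eta>_def .
  then have t: "admissible_widening t"
    using t_pos \<mu>_pos by (simp add: admissible_widening_def)
  \<comment> \<open>The term \<open>4 / 3 * w_max * L\<close> of \<open>m * \<eta>\<close>, multiplied by \<open>2 - \<alpha> = 1 + (1 - \<alpha>)\<close>, pays for the
    linear term \<open>w_max * L\<close> of Bernstein's bound and, since \<open>L \<ge> 1\<close>, also for \<open>(1 - \<alpha>) * w_max\<close>.\<close>
  have margin: "2 * sqrt (m * (1 + chi_square PX w) * L) + w_max * L + (1 - \<alpha>) * w_max
      \<le> m * (2 * \<mu>_low * t - \<mu>_up * (2 * R * e))"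
  proof -
    define s where "s = sqrt (m * (1 + chi_square PX w) * L)"
    have s: "0 \<le> s" using chi_square_nonneg L by (simp add: s_def)
    have wL: "w_max \<le> w_max * L" using mult_left_mono[OF L, of w_max] w_max_ge_1 by simp
    then have "(1 - \<alpha>) * w_max \<le> (1 - \<alpha>) * (w_max * L)" using \<alpha> by (intro mult_left_mono) auto
    moreover have "0 \<le> (1 - \<alpha>) * s" "0 \<le> (1 - \<alpha>) * (w_max * L)" "0 \<le> w_max * L"
      using \<alpha> s w_max_ge_1 L by simp_all
    moreover have "(2 - \<alpha>) * (9 * s + 4 / 3 * w_max * L)
        = 9 * s + 4 / 3 * (w_max * L) + 9 * ((1 - \<alpha>) * s) + 4 / 3 * ((1 - \<alpha>) * (w_max * L))"
      by (simp add: field_simps)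
    ultimately have "2 * s + w_max * L + (1 - \<alpha>) * w_max \<le> (2 - \<alpha>) * (9 * s + 4 / 3 * w_max * L)"
      using s by linarith
    also have "\<dots> = (2 - \<alpha>) * (m * \<eta>)" by (simp add: m_\<eta> s_def)
    also have "\<dots> = m * (2 * \<mu>_low * t - \<mu>_up * (2 * R * e))"
      unfolding low_t by (simp add: algebra_simps)
    finally show ?thesis by (simp add: s_def)
  qed

  define T where "T = {D \<in> space N. \<forall>\<tau>\<in>{\<alpha>/2, 1 - \<alpha>/2}.
      Lp_norm p PX (\<lambda>x. ereal (f n D \<tau> x - cond_quantile K \<tau> x)) \<le> ennreal e}"
  define T' where "T' \<tau> = {D \<in> space N. Lp_norm p PX (\<lambda>x. ereal (f n D \<tau> x - cond_quantile K \<tau> x)) \<le> ennreal e}" for \<tau>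
  have T'_prob: "1 - \<delta>/4 \<le> measure N (T' \<tau>)" if "\<tau> \<in> {\<alpha>/2, 1 - \<alpha>/2}" for \<tau>
    unfolding T'_def using acc(2)[OF that] .
  \<comment> \<open>A non-measurable set has measure \<open>0\<close>, so the accuracy assumption implies measurability.\<close>
  have T'_sets: "T' \<tau> \<in> sets N" if "\<tau> \<in> {\<alpha>/2, 1 - \<alpha>/2}" for \<tau>
    using T'_prob[OF that] \<delta> by (intro ccontr[of "T' \<tau> \<in> sets N"]) (simp add: measure_notin_sets)
  have T_eq: "T = T' (\<alpha>/2) \<inter> T' (1 - \<alpha>/2)" by (auto simp: T_def T'_def)
  have T_sets: "T \<in> sets N" unfolding T_eq using T'_sets by auto
  have T_prob: "1 - \<delta>/2 \<le> measure N T"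
  proof -
    have "measure N (space N - T) \<le> measure N ((space N - T' (\<alpha>/2)) \<union> (space N - T' (1 - \<alpha>/2)))"
      using T'_sets T_sets by (intro N.finite_measure_mono) (auto simp: T_eq)
    also have "\<dots> \<le> measure N (space N - T' (\<alpha>/2)) + measure N (space N - T' (1 - \<alpha>/2))"
      using T'_sets by (intro measure_Un_le) auto
    also have "\<dots> \<le> \<delta>/4 + \<delta>/4"
      using T'_sets T'_prob[of "\<alpha>/2"] T'_prob[of "1 - \<alpha>/2"] by (simp add: N.prob_compl)
    finally show ?thesis using T_sets by (simp add: N.prob_compl)
  qed

  have f_measurable: "(\<lambda>(D, x). f n D \<tau> x) \<in> borel_measurable (N \<Otimes>\<^sub>M PX)" if "\<tau> \<in> {\<alpha>/2, 1 - \<alpha>/2}" for \<tau>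
    using assms(8,18) that unfolding measurable_training_def N_def by blast
  have g: "endpoints_measurable (f n D)" if "D \<in> space N" for D
    using measurable_Pair2[OF f_measurable that] by (auto simp: endpoints_measurable_def)

  define B where "B = {z \<in> space (N \<Otimes>\<^sub>M M). fst z \<in> T \<and> calibrated (f n (fst z)) m t (snd z)}"
  have B_sets: "B \<in> sets (N \<Otimes>\<^sub>M M)"
  proof -
    have cw[measurable]: "(\<lambda>z. centred_weight (f n (fst z)) s (snd z j)) \<in> borel_measurable (N \<Otimes>\<^sub>M M)"
      if j: "j < m" for s j
    proof -
      have [measurable]: "(\<lambda>z. snd z j) \<in> N \<Otimes>\<^sub>M M \<rightarrow>\<^sub>M PX \<Otimes>\<^sub>M borel"
        using measurable_snd sample_component[OF PX K j, folded M_def] by (rule measurable_compose)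
      have [measurable]: "(\<lambda>z. f n (fst z) \<tau> (fst (snd z j))) \<in> borel_measurable (N \<Otimes>\<^sub>M M)"
        if "\<tau> \<in> {\<alpha>/2, 1 - \<alpha>/2}" for \<tau>
      proof -
        have "(\<lambda>z. (fst z, fst (snd z j))) \<in> N \<Otimes>\<^sub>M M \<rightarrow>\<^sub>M N \<Otimes>\<^sub>M PX" by measurable
        from measurable_compose[OF this f_measurable[OF that]] show ?thesis by simp
      qed
      show ?thesis
        unfolding centred_weight_def score_def lower_endpoint_def upper_endpoint_def by measurable
    qed
    have [measurable]: "(\<lambda>z. \<Sum>j<m. centred_weight (f n (fst z)) s (snd z j)) \<in> borel_measurable (N \<Otimes>\<^sub>M M)" for s
      by (intro borel_measurable_sum cw) simp
    note [measurable] = T_sets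
    show ?thesis unfolding B_def calibrated_def by measurable
  qed
  have B_section: "1 - \<delta>/2 \<le> measure M (Pair D -` B)" if D: "D \<in> T" for D
  proof -
    have D_space: "D \<in> space N" using D by (simp add: T_def)
    have mean: "(\<integral>\<^sup>+x. ennreal (endpoint_error (f n D) x) \<partial>QX) \<le> ennreal (2 * R * e)"
      unfolding R_def using D acc(1) by (intro endpoint_error_mean[OF g[OF D_space] p]) (auto simp: T_def)
    have "1 - 2 * exp (- L) \<le> measure M {C \<in> space M. calibrated (f n D) m t C}"
      unfolding M_def using R acc(1) L
      by (intro calibration_probability[OF g[OF D_space] t _ mean m _ margin]) auto
    moreover have "Pair D -` B = {C \<in> space M. calibrated (f n D) m t C}"
      using D D_space by (auto simp: B_def space_pair_measure)
    ultimately show ?thesis by (simp add: exp_L)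
  qed

  define A where "A = (\<lambda>\<omega>. (Dtr \<omega>, Dcal \<omega>)) -` B \<inter> space \<Omega>"
  have pair: "(\<lambda>\<omega>. (Dtr \<omega>, Dcal \<omega>)) \<in> \<Omega> \<rightarrow>\<^sub>M N \<Otimes>\<^sub>M M"
    using assms(11,13) unfolding N_def M_def by (rule measurable_Pair)
  have law: "distr \<Omega> (N \<Otimes>\<^sub>M M) (\<lambda>\<omega>. (Dtr \<omega>, Dcal \<omega>)) = N \<Otimes>\<^sub>M M"
    using assms(12,14,15) unfolding N_def M_def by (simp add: \<Omega>.indep_var_distribution_eq)
  show ?thesis
  proof (intro exI[of _ A] conjI ballI)
    show "A \<in> sets (vimage_algebra (space \<Omega>) (\<lambda>\<omega>. (Dtr \<omega>, Dcal \<omega>)) (sample_law PX K n \<Otimes>\<^sub>M sample_law PX K m))"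
      unfolding A_def by (rule in_vimage_algebra[OF B_sets[unfolded N_def M_def]])
    have "1 - \<delta> \<le> (1 - \<delta>/2) * (1 - \<delta>/2)" by (simp add: algebra_simps)
    also have "\<dots> \<le> measure (N \<Otimes>\<^sub>M M) B"
      using \<delta> B_section T_prob
      by (intro product_prob_ge[OF N.prob_space_axioms M.prob_space_axioms B_sets T_sets]) auto
    also have "\<dots> = measure \<Omega> A"
      unfolding A_def using measure_distr[OF pair B_sets] by (simp add: law)
    finally show "1 - \<delta> \<le> measure \<Omega> A" .
  next
    fix \<omega> assume \<omega>: "\<omega> \<in> A"
    define D where "D = Dtr \<omega>"
    define C where "C = Dcal \<omega>"
    have D: "D \<in> space N" "D \<in> T" and C: "C \<in> space M" and cal: "calibrated (f n D) m t C"
      using \<omega> by (auto simp: A_def B_def D_def C_def space_pair_measure)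
    have C_space: "fst (C i) \<in> space PX" if "i < m" for i
      using measurable_space[OF sample_component[OF PX K that, folded M_def] C]
      by (auto simp: space_pair_measure)
    show "AE x in QX. \<bar>weighted_threshold \<alpha> w (f n (Dtr \<omega>)) m (Dcal \<omega>) x\<bar> \<noteq> \<infinity>"
    proof (rule AE_I2)
      fix x assume "x \<in> space QX"
      then show "\<bar>weighted_threshold \<alpha> w (f n (Dtr \<omega>)) m (Dcal \<omega>) x\<bar> \<noteq> \<infinity>"
        using calibrated_threshold[OF cal C_space, of x] by (auto simp: D_def C_def)
    qed
    have "Lp_norm p QX (\<lambda>x. len (weighted_cqr_set \<alpha> w (f n D) m C x) - len (oracle_interval K \<alpha> x))
        \<le> ennreal (2 * R * e + 2 * t)"
      unfolding R_def using D acc(1)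
      by (intro length_error_Lp_norm[OF g[OF D(1)] p _ _ _ cal C_space t_pos]) (auto simp: T_def)
    also have "2 * R * e + 2 * t = 2 * (1 + \<mu>_up / \<mu>_low) * R * e + (2 - \<alpha>) * \<eta> / \<mu>_low"
      using \<mu>_pos by (simp add: t_def field_simps)
    also have "ennreal \<dots> = ennreal (2 * (1 + \<mu>_up / \<mu>_low) * R * e) + ennreal ((2 - \<alpha>) * \<eta>) / ennreal \<mu>_low"
      using \<mu>_pos R acc(1) \<alpha> \<eta> by (subst ennreal_plus) (simp_all add: divide_ennreal)
    also have "\<dots> \<le> ennreal (2 * (1 + \<mu>_up / \<mu>_low) * R * e)
        + (ennreal ((2 - \<alpha>) * \<eta>) + ennreal (1 - \<alpha>) * Lp_norm p QX (\<lambda>x. ereal (w x)) / of_nat m) / ennreal \<mu>_low"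
      by (intro add_left_mono divide_right_mono_ennreal) simp
    finally show "Lp_norm p QX (\<lambda>x. len (weighted_cqr_set \<alpha> w (f n (Dtr \<omega>)) m (Dcal \<omega>) x)
                                  - len (oracle_interval K \<alpha> x))
                  \<le> ennreal (2 * (1 + \<mu>_up / \<mu>_low) * root_exponent w_max p * \<epsilon> n (\<delta>/4))
                    + (ennreal ((2 - \<alpha>) * eta_w PX w w_max m \<delta>)
                       + ennreal (1 - \<alpha>) * Lp_norm p QX (\<lambda>x. ereal (w x)) / of_nat m)
                      / ennreal \<mu>_low"
      unfolding D_def C_def R_def e_def \<eta>_def .
  qed
qed

end
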